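(* Let $X$ be a set and $Z$ be a subset of $X$. Then for every separable metric group topology $\mathscr{T}$ on $F(Z)$ there exists a Hausdorff group topology $\mathscr{T}'$ on $F(X)$ inducing the original topology $\mathscr{T}$ on $F(Z)$; that is, $(F(Z),\mathscr{T})$ is a subspace of $(F(X),\mathscr{T}')$.
   Context: $F(X)$ denotes the free group over a set $X$. For $Z\subseteq X$, the group $F(Z)$ is identified with the subgroup of $F(X)$ generated by $Z$. A separable metric group topology on a group is a group topology that is separable and metrizable. *)

theory Defs
  imports "HOL-Analysis.Analysis" "HOL-Algebra.Elementary_Groups"
begin

text \<open>
  The free group on a set is realised by reduced words. The letter \<open>(x, True)\<close> stands
  for the generator \<open>x\<close> and \<open>(x, False)\<close> for its formal inverse.
\<close>

type_synonym 'a free_word = "('a \<times> bool) list"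

definition inv_letter :: "'a \<times> bool \<Rightarrow> 'a \<times> bool" where
  "inv_letter a = (fst a, \<not> snd a)"

definition reduced_word :: "'a free_word \<Rightarrow> bool" where
  "reduced_word w \<longleftrightarrow> successively (\<lambda>a b. b \<noteq> inv_letter a) w"

text \<open>Prepend one letter to a reduced word, cancelling it against the head if possible.\<close>

fun cons_letter :: "'a \<times> bool \<Rightarrow> 'a free_word \<Rightarrow> 'a free_word" where
  "cons_letter a [] = [a]"
| "cons_letter a (b # w) = (if b = inv_letter a then w else a # b # w)"

definition reduce_word :: "'a free_word \<Rightarrow> 'a free_word" where
  "reduce_word w = foldr cons_letter w []"

definition free_group :: "'a set \<Rightarrow> 'a free_word monoid" where
  "free_group X =
     \<lparr>carrier = {w. reduced_word w \<and> fst ` set w \<subseteq> X}, mult = (\<lambda>u v. reduce_word (u @ v)), one = []\<rparr>"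

definition free_gen :: "'a \<Rightarrow> 'a free_word" where
  "free_gen x = [(x, True)]"

lemma carrier_free_group: "carrier (free_group X) = {w. reduced_word w \<and> fst ` set w \<subseteq> X}"
  by (simp add: free_group_def)

lemma mult_free_group: "u \<otimes>\<^bsub>free_group X\<^esub> v = reduce_word (u @ v)"
  by (simp add: free_group_def)

lemma one_free_group: "\<one>\<^bsub>free_group X\<^esub> = []"
  by (simp add: free_group_def)

lemma inv_letter_invol [simp]: "inv_letter (inv_letter a) = a"
  by (simp add: inv_letter_def)

lemma fst_inv_letter [simp]: "fst (inv_letter a) = fst a"
  by (simp add: inv_letter_def)

lemma reduced_Nil [simp]: "reduced_word []"
  by (simp add: reduced_word_def)

lemma reduced_Cons: "reduced_word (a # w) \<longleftrightarrow> reduced_word w \<and> (w = [] \<or> hd w \<noteq> inv_letter a)"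
  by (cases w) (auto simp: reduced_word_def)

lemma reduced_cons_letter: "reduced_word w \<Longrightarrow> reduced_word (cons_letter a w)"
  by (cases w) (auto simp: reduced_Cons)

lemma cons_letter_reduced: "reduced_word (a # w) \<Longrightarrow> cons_letter a w = a # w"
  by (cases w) (auto simp: reduced_Cons)

lemma cons_letter_cancel: "reduced_word w \<Longrightarrow> cons_letter a (cons_letter (inv_letter a) w) = w"
  by (cases w) (auto simp: reduced_Cons cons_letter_reduced)

lemma reduced_foldr: "reduced_word w \<Longrightarrow> reduced_word (foldr cons_letter u w)"
  by (induction u) (auto simp: reduced_cons_letter)

lemma reduced_reduce: "reduced_word (reduce_word w)"
  by (simp add: reduce_word_def reduced_foldr)

lemma reduce_reduced: "reduced_word w \<Longrightarrow> reduce_word w = w"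
  by (induction w) (auto simp: reduce_word_def reduced_Cons cons_letter_reduced)

lemma foldr_cons_letter:
  assumes "reduced_word w"
  shows "foldr cons_letter (cons_letter a u) w = cons_letter a (foldr cons_letter u w)"
proof (cases u)
  case (Cons b v)
  then show ?thesis
    using cons_letter_cancel[OF reduced_foldr[OF assms], of a v] by auto
qed simp

lemma foldr_reduce:
  assumes "reduced_word w"
  shows "foldr cons_letter (reduce_word u) w = foldr cons_letter u w"
  by (induction u) (auto simp: reduce_word_def foldr_cons_letter assms)

lemma reduce_append: "reduce_word (u @ v) = foldr cons_letter u (reduce_word v)"
  by (simp add: reduce_word_def)

lemma reduce_append_left: "reduce_word (reduce_word u @ v) = reduce_word (u @ v)"
  by (simp add: reduce_append foldr_reduce reduced_reduce)

lemma reduce_append_right: "reduce_word (u @ reduce_word v) = reduce_word (u @ v)"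
  by (simp add: reduce_append reduce_reduced reduced_reduce)

lemma set_cons_letter: "set (cons_letter a w) \<subseteq> insert a (set w)"
  by (cases w) auto

lemma set_reduce: "set (reduce_word w) \<subseteq> set w"
proof (induction w)
  case (Cons a w)
  then show ?case
    using set_cons_letter[of a "reduce_word w"] by (auto simp: reduce_word_def)
qed (simp add: reduce_word_def)

definition inv_word :: "'a free_word \<Rightarrow> 'a free_word" where
  "inv_word w = rev (map inv_letter w)"

lemma reduce_inv_word: "reduce_word (inv_word w @ w) = []"
proof (induction w)
  case (Cons a w)
  have "cons_letter (inv_letter a) (cons_letter a (reduce_word w)) = reduce_word w"
    using cons_letter_cancel[OF reduced_reduce, of "inv_letter a" w] by simp
  then have "reduce_word ([inv_letter a] @ a # w) = reduce_word w"
    by (simp add: reduce_word_def)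
  then show ?case
    using Cons reduce_append_right[of "inv_word w" "[inv_letter a] @ a # w"]
      reduce_append_right[of "inv_word w" w]
    by (simp add: inv_word_def)
qed (simp add: reduce_word_def inv_word_def)

lemma set_inv_word: "fst ` set (inv_word w) = fst ` set w"
  by (simp add: inv_word_def image_image)

theorem group_free_group: "group (free_group X)"
proof (rule groupI)
  fix u v w
  assume "u \<in> carrier (free_group X)" "v \<in> carrier (free_group X)"
  then show "u \<otimes>\<^bsub>free_group X\<^esub> v \<in> carrier (free_group X)"
    using image_mono[OF set_reduce, of fst "u @ v"]
    by (simp add: carrier_free_group mult_free_group reduced_reduce image_Un) blast
next
  fix u v w
  show "u \<otimes>\<^bsub>free_group X\<^esub> v \<otimes>\<^bsub>free_group X\<^esub> w
      = u \<otimes>\<^bsub>free_group X\<^esub> (v \<otimes>\<^bsub>free_group X\<^esub> w)"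
    by (simp add: mult_free_group reduce_append_left reduce_append_right)
next
  fix u
  assume u: "u \<in> carrier (free_group X)"
  then show "\<one>\<^bsub>free_group X\<^esub> \<otimes>\<^bsub>free_group X\<^esub> u = u"
    by (simp add: carrier_free_group mult_free_group one_free_group reduce_reduced)
  have "reduce_word (inv_word u) \<in> carrier (free_group X)"
    using u image_mono[OF set_reduce, of fst "inv_word u"]
    by (simp add: carrier_free_group reduced_reduce set_inv_word) blast
  moreover have "reduce_word (inv_word u) \<otimes>\<^bsub>free_group X\<^esub> u = \<one>\<^bsub>free_group X\<^esub>"
    by (simp add: mult_free_group one_free_group reduce_append_left reduce_inv_word)
  ultimately show "\<exists>v\<in>carrier (free_group X). v \<otimes>\<^bsub>free_group X\<^esub> u = \<one>\<^bsub>free_group X\<^esub>"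
    by blast
qed (simp add: carrier_free_group one_free_group)

lemma free_gen_in_carrier: "x \<in> X \<Longrightarrow> free_gen x \<in> carrier (free_group X)"
  by (simp add: carrier_free_group free_gen_def reduced_Cons)

lemma singleton_in_carrier: "fst a \<in> X \<Longrightarrow> [a] \<in> carrier (free_group X)"
  by (simp add: carrier_free_group reduced_Cons)

lemma inv_free_gen:
  assumes "x \<in> X"
  shows "inv\<^bsub>free_group X\<^esub> (free_gen x) = [(x, False)]"
proof (rule group.inv_equality[OF group_free_group])
  show "[(x, False)] \<otimes>\<^bsub>free_group X\<^esub> free_gen x = \<one>\<^bsub>free_group X\<^esub>"
    by (simp add: mult_free_group one_free_group free_gen_def reduce_word_def inv_letter_def)
qed (use assms in \<open>auto simp: free_gen_in_carrier intro: singleton_in_carrier\<close>)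

lemma Cons_free_group:
  assumes "reduced_word (a # w)"
  shows "a # w = [a] \<otimes>\<^bsub>free_group X\<^esub> w"
  using reduce_reduced[OF assms] by (simp add: mult_free_group)

lemma carrier_free_group_eq_generate:
  assumes "Z \<subseteq> X"
  shows "carrier (free_group Z) = generate (free_group X) (free_gen ` Z)"
proof (intro equalityI subsetI)
  fix w
  assume "w \<in> carrier (free_group Z)"
  then show "w \<in> generate (free_group X) (free_gen ` Z)"
  proof (induction w)
    case Nil
    show ?case
      using generate.one[of "free_group X"] by (simp add: one_free_group)
  next
    case (Cons a w)
    obtain x b where a: "a = (x, b)" by (rule prod.exhaust)
    have x: "x \<in> Z" and r: "reduced_word (a # w)" and w: "w \<in> carrier (free_group Z)"
      using Cons.prems by (simp_all add: carrier_free_group a reduced_Cons)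
    have "[a] \<in> generate (free_group X) (free_gen ` Z)"
    proof (cases b)
      case True
      then show ?thesis
        using generate.incl[of "free_gen x" "free_gen ` Z" "free_group X"] x
        by (simp add: a free_gen_def)
    next
      case False
      have "x \<in> X"
        using x assms by blast
      then have "[a] = inv\<^bsub>free_group X\<^esub> (free_gen x)"
        using False by (simp add: a inv_free_gen)
      then show ?thesis
        using generate.inv[of "free_gen x" "free_gen ` Z" "free_group X"] x by simp
    qed
    then show ?case
      by (subst Cons_free_group[OF r, of X]) (rule generate.eng[OF _ Cons.IH[OF w]])
  qed
next
  fix w
  assume "w \<in> generate (free_group X) (free_gen ` Z)"
  then show "w \<in> carrier (free_group Z)"
  proof induction
    case one
    show ?case by (simp add: one_free_group carrier_free_group)
  next
    case (incl h)
    then obtain x where "x \<in> Z" "h = free_gen x" by blast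
    then show ?case by (simp add: free_gen_in_carrier)
  next
    case (inv h)
    then obtain x where x: "x \<in> Z" "h = free_gen x" by blast
    then have "inv\<^bsub>free_group X\<^esub> h = [(x, False)]"
      using assms inv_free_gen[of x X] by blast
    then show ?case
      using x singleton_in_carrier[of "(x, False)" Z] by simp
  next
    case (eng h1 h2)
    have "h1 \<otimes>\<^bsub>free_group Z\<^esub> h2 \<in> carrier (free_group Z)"
      by (rule monoid.m_closed[OF group.is_monoid[OF group_free_group] eng.IH])
    then show ?case by (simp add: mult_free_group)
  qed
qed

text \<open>
  For \<open>Z \<subseteq> X\<close> the group \<open>free_group Z\<close> is literally the subgroup of \<open>free_group X\<close>
  generated by \<open>Z\<close>.
\<close>

theorem free_group_eq_subgroup_generated:
  assumes "Z \<subseteq> X"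
  shows "free_group Z = subgroup_generated (free_group X) (free_gen ` Z)"
proof -
  have "free_gen x \<in> carrier (free_group X)" if "x \<in> Z" for x
    using assms that by (intro free_gen_in_carrier) blast
  then have "carrier (free_group X) \<inter> free_gen ` Z = free_gen ` Z"
    by blast
  then have "carrier (free_group Z) = generate (free_group X) (carrier (free_group X) \<inter> free_gen ` Z)"
    using carrier_free_group_eq_generate[OF assms] by simp
  then show ?thesis
    by (simp add: subgroup_generated_def free_group_def)
qed

text \<open>
  The universal property of the free group. Uniqueness of the extension holds because
  \<open>free_gen ` X\<close> generates \<open>free_group X\<close>.
\<close>

theorem free_group_universal:
  assumes "group H" and f: "f \<in> X \<rightarrow> carrier H"
  shows "\<exists>h \<in> hom (free_group X) H. \<forall>x\<in>X. h (free_gen x) = f x"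
proof -
  interpret H: group H by fact
  define l where "l = (\<lambda>a. if fst a \<in> X then (if snd a then f (fst a) else inv\<^bsub>H\<^esub> f (fst a)) else \<one>\<^bsub>H\<^esub>)"
  define h where "h = (\<lambda>w. foldr (\<lambda>a r. l a \<otimes>\<^bsub>H\<^esub> r) w \<one>\<^bsub>H\<^esub>)"
  have l: "l a \<in> carrier H" for a
    using f by (auto simp: l_def)
  have l_inv: "l a \<otimes>\<^bsub>H\<^esub> l (inv_letter a) = \<one>\<^bsub>H\<^esub>" for a
    using funcset_mem[OF f, of "fst a"] by (auto simp: l_def inv_letter_def)
  have h_simps: "h [] = \<one>\<^bsub>H\<^esub>" "h (a # w) = l a \<otimes>\<^bsub>H\<^esub> h w" for a w
    by (simp_all add: h_def)
  have h: "h w \<in> carrier H" for w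
    by (induction w) (auto simp: h_simps l)
  have h_app: "h (u @ v) = h u \<otimes>\<^bsub>H\<^esub> h v" for u v
    by (induction u) (auto simp: h_simps l h H.m_assoc)
  have h_cons: "h (cons_letter a w) = l a \<otimes>\<^bsub>H\<^esub> h w" for a w
  proof (cases w)
    case (Cons b v)
    have "l a \<otimes>\<^bsub>H\<^esub> (l (inv_letter a) \<otimes>\<^bsub>H\<^esub> h v) = h v"
      by (simp add: H.m_assoc[symmetric] l h l_inv)
    then show ?thesis by (simp add: Cons h_simps)
  qed (simp add: h_simps)
  have h_red: "h (reduce_word w) = h w" for w
    by (induction w) (auto simp: reduce_word_def h_simps h_cons)
  have "h \<in> hom (free_group X) H"
    by (auto simp: hom_def h h_red h_app mult_free_group)
  moreover have "\<forall>x\<in>X. h (free_gen x) = f x"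
    using funcset_mem[OF f] by (simp add: free_gen_def h_simps l_def)
  ultimately show ?thesis by blast
qed

definition group_topology :: "('a, 'b) monoid_scheme \<Rightarrow> 'a topology \<Rightarrow> bool" where
  "group_topology G T \<longleftrightarrow>
     group G \<and> topspace T = carrier G \<and>
     continuous_map (prod_topology T T) T (\<lambda>(x, y). x \<otimes>\<^bsub>G\<^esub> y) \<and>
     continuous_map T T (\<lambda>x. inv\<^bsub>G\<^esub> x)"

definition separable_metric_group_topology :: "('a, 'b) monoid_scheme \<Rightarrow> 'a topology \<Rightarrow> bool" where
  "separable_metric_group_topology G T \<longleftrightarrow>
     group_topology G T \<and> separable_space T \<and> metrizable_space T"

end

theory Submission
  imports Defs
begin

text \<open>
  Write \<open>G = F(Z)\<close>, \<open>P = F(X)\<close>, and let \<open>r : P \<rightarrow> G\<close> be the retraction that deletes all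
  letters outside \<open>Z\<close>. The kernel of \<open>r\<close> is free on the conjugates \<open>h y h\<^sup>-\<^sup>1\<close> with \<open>h \<in> G\<close> and
  \<open>y \<in> X - Z\<close>, and \<open>G\<close> acts on this basis by left translation of \<open>h\<close>. If \<open>d\<close> is a
  left-invariant metric on \<open>G\<close>, then it is an invariant metric on the basis, so the bi-invariant
  Graev metric that it induces on the free group \<open>ker r\<close> is invariant under the action of \<open>G\<close>;
  moreover \<open>G\<close> acts continuously. Hence the product topology on the semidirect product
  \<open>P = ker r \<rtimes> G\<close> is a Hausdorff group topology, and it restricts to the given topology on \<open>G\<close>.

  All metrics are presented by length functions (\<open>L(xy) \<le> L(x) + L(y)\<close>, \<open>L(x\<^sup>-\<^sup>1) = L(x)\<close>), the
  metric being \<open>L(x\<^sup>-\<^sup>1 y)\<close>; such a metric yields a group topology as soon as conjugation by each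
  fixed element is continuous at the identity (\<open>group_topology_length_topology\<close>). The length
  \<open>N\<close> of \<open>G\<close> comes from the theorem of Birkhoff and Kakutani. The Graev length \<open>k\<close> is the largest
  length on the kernel that is bounded by \<open>1\<close> and satisfies
  \<open>k(u [y, g] u\<^sup>-\<^sup>1) \<le> N(g)\<close> for all \<open>u \<in> P\<close>, where \<open>[y, g]\<close> is the
  commutator, because \<open>(h y h\<^sup>-\<^sup>1)(hg y (hg)\<^sup>-\<^sup>1)\<^sup>-\<^sup>1 = h [y, g] h\<^sup>-\<^sup>1\<close>. The length on \<open>P\<close> is
  \<open>L(p) = N(r p) + k(p (r p)\<^sup>-\<^sup>1)\<close>. Both \<open>N\<close> and \<open>k\<close> are infima of costs of factorizations,
  which \<open>weighted_length\<close> treats once and for all.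

  The heart of the matter is that \<open>k\<close> vanishes at the identity only (\<open>k_definite\<close>). A
  kernel element \<open>p \<noteq> 1\<close> is a nonempty reduced word in finitely many basis elements
  \<open>h y h\<^sup>-\<^sup>1\<close>. Let \<open>0 < e \<le> 1\<close> be a lower bound for the distances between the different \<open>h\<close> that occur.
  If \<open>p\<close> were a product of elements \<open>u\<^sub>i [y\<^sub>i, g\<^sub>i] u\<^sub>i\<^sup>-\<^sup>1\<close> with \<open>\<Sum> N(g\<^sub>i) < e\<close>, then
  gluing \<open>r u\<^sub>i\<close> to \<open>(r u\<^sub>i) g\<^sub>i\<close> for all \<open>i\<close> would not identify any two of the \<open>h\<close>
  (\<open>separating_quotient\<close>). The induced homomorphism of free groups kills every factor,
  whereas it maps the reduced word \<open>p\<close> to a reduced word of the same positive length.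
\<close>

section \<open>Group topologies given by length functions\<close>

definition length_topology :: "('a, 'b) monoid_scheme \<Rightarrow> ('a \<Rightarrow> real) \<Rightarrow> 'a topology" where
  "length_topology G L =
     topology (\<lambda>U. U \<subseteq> carrier G \<and>
       (\<forall>x\<in>U. \<exists>e>0. \<forall>y\<in>carrier G. L (inv\<^bsub>G\<^esub> x \<otimes>\<^bsub>G\<^esub> y) < e \<longrightarrow> y \<in> U))"

lemma openin_length_topology:
  "openin (length_topology G L) U \<longleftrightarrow>
     U \<subseteq> carrier G \<and> (\<forall>x\<in>U. \<exists>e>0. \<forall>y\<in>carrier G. L (inv\<^bsub>G\<^esub> x \<otimes>\<^bsub>G\<^esub> y) < e \<longrightarrow> y \<in> U)"
proof -
  let ?op = "\<lambda>U. U \<subseteq> carrier G \<and>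
    (\<forall>x\<in>U. \<exists>e>0. \<forall>y\<in>carrier G. L (inv\<^bsub>G\<^esub> x \<otimes>\<^bsub>G\<^esub> y) < e \<longrightarrow> y \<in> U)"
  have "istopology ?op"
    unfolding istopology_def
  proof (intro conjI allI impI)
    fix S S' assume S: "?op S" and S': "?op S'"
    show "S \<inter> S' \<subseteq> carrier G" using S by blast
    show "\<forall>x\<in>S \<inter> S'. \<exists>e>0. \<forall>y\<in>carrier G. L (inv\<^bsub>G\<^esub> x \<otimes>\<^bsub>G\<^esub> y) < e \<longrightarrow> y \<in> S \<inter> S'"
    proof
      fix x assume x: "x \<in> S \<inter> S'"
      obtain e where e: "e > 0" "\<forall>y\<in>carrier G. L (inv\<^bsub>G\<^esub> x \<otimes>\<^bsub>G\<^esub> y) < e \<longrightarrow> y \<in> S"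
        using S x by blast
      obtain e' where e': "e' > 0" "\<forall>y\<in>carrier G. L (inv\<^bsub>G\<^esub> x \<otimes>\<^bsub>G\<^esub> y) < e' \<longrightarrow> y \<in> S'"
        using S' x by blast
      show "\<exists>e>0. \<forall>y\<in>carrier G. L (inv\<^bsub>G\<^esub> x \<otimes>\<^bsub>G\<^esub> y) < e \<longrightarrow> y \<in> S \<inter> S'"
        by (rule exI[of _ "min e e'"]) (use e e' in auto)
    qed
  next
    fix K assume K: "\<forall>S\<in>K. ?op S"
    show "\<Union> K \<subseteq> carrier G" using K by blast
    show "\<forall>x\<in>\<Union> K. \<exists>e>0. \<forall>y\<in>carrier G. L (inv\<^bsub>G\<^esub> x \<otimes>\<^bsub>G\<^esub> y) < e \<longrightarrow> y \<in> \<Union> K"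
      using K by (meson UnionE UnionI)
  qed
  then show ?thesis
    by (simp add: length_topology_def topology_inverse')
qed

lemma topspace_length_topology [simp]: "topspace (length_topology G L) = carrier G"
proof
  have "openin (length_topology G L) (carrier G)"
    by (auto simp: openin_length_topology intro: exI[of _ 1])
  then show "carrier G \<subseteq> topspace (length_topology G L)"
    by (rule openin_subset)
  show "topspace (length_topology G L) \<subseteq> carrier G"
    using openin_topspace[of "length_topology G L"] unfolding openin_length_topology by blast
qed

text \<open>
  Together with associativity these two rewrite rules normalize words in a group, so that
  the simplifier decides the identities between products and inverses below.
\<close>

lemma (in group) mult_inv_cancel_left:
  assumes "x \<in> carrier G" "y \<in> carrier G"
  shows "x \<otimes> (inv x \<otimes> y) = y" "inv x \<otimes> (x \<otimes> y) = y"
  using assms by (simp_all add: m_assoc[symmetric])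

locale group_length = group G for G (structure) +
  fixes L :: "'a \<Rightarrow> real"
  assumes length_nonneg: "x \<in> carrier G \<Longrightarrow> 0 \<le> L x"
    and length_one: "L \<one> = 0"
    and length_mult: "\<lbrakk>x \<in> carrier G; y \<in> carrier G\<rbrakk> \<Longrightarrow> L (x \<otimes> y) \<le> L x + L y"
    and length_inv: "x \<in> carrier G \<Longrightarrow> L (inv x) = L x"
begin

lemma length_diff_commute:
  assumes "x \<in> carrier G" "y \<in> carrier G"
  shows "L (inv x \<otimes> y) = L (inv y \<otimes> x)"
  using length_inv[of "inv x \<otimes> y"] assms by (simp add: inv_mult_group)

lemma length_diff_triangle:
  assumes "x \<in> carrier G" "y \<in> carrier G" "z \<in> carrier G"
  shows "L (inv x \<otimes> z) \<le> L (inv x \<otimes> y) + L (inv y \<otimes> z)"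
proof -
  have "inv x \<otimes> z = (inv x \<otimes> y) \<otimes> (inv y \<otimes> z)"
    using assms by (simp add: m_assoc mult_inv_cancel_left)
  then show ?thesis
    using length_mult[of "inv x \<otimes> y" "inv y \<otimes> z"] assms by simp
qed

lemma openin_length_ball:
  assumes x: "x \<in> carrier G"
  shows "openin (length_topology G L) {y \<in> carrier G. L (inv x \<otimes> y) < e}"
  unfolding openin_length_topology
proof (intro conjI ballI)
  fix y assume "y \<in> {y \<in> carrier G. L (inv x \<otimes> y) < e}"
  then have y: "y \<in> carrier G" "L (inv x \<otimes> y) < e" by auto
  have "L (inv x \<otimes> z) < e" if "z \<in> carrier G" "L (inv y \<otimes> z) < e - L (inv x \<otimes> y)" for z
    using length_diff_triangle[OF x y(1) that(1)] that(2) by linarith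
  then show "\<exists>e'>0. \<forall>z\<in>carrier G. L (inv y \<otimes> z) < e' \<longrightarrow> z \<in> {y \<in> carrier G. L (inv x \<otimes> y) < e}"
    using y by (intro exI[of _ "e - L (inv x \<otimes> y)"]) simp
qed auto

lemma Hausdorff_length_topology:
  assumes definite: "\<And>x. x \<in> carrier G \<Longrightarrow> L x = 0 \<Longrightarrow> x = \<one>"
  shows "Hausdorff_space (length_topology G L)"
  unfolding Hausdorff_space_def
proof (intro allI impI)
  fix x y assume "x \<in> topspace (length_topology G L) \<and> y \<in> topspace (length_topology G L) \<and> x \<noteq> y"
  then have x: "x \<in> carrier G" and y: "y \<in> carrier G" and "x \<noteq> y" by auto
  define e where "e = L (inv x \<otimes> y) / 2"
  have "inv x \<otimes> y \<noteq> \<one>"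
  proof
    assume "inv x \<otimes> y = \<one>"
    then have "x = y"
      using mult_inv_cancel_left(1)[OF x y] x by simp
    then show False using \<open>x \<noteq> y\<close> by simp
  qed
  then have "L (inv x \<otimes> y) \<noteq> 0"
    using definite[of "inv x \<otimes> y"] x y by auto
  then have e: "e > 0"
    using length_nonneg[of "inv x \<otimes> y"] x y by (simp add: e_def)
  let ?U = "{z \<in> carrier G. L (inv x \<otimes> z) < e}" and ?V = "{z \<in> carrier G. L (inv y \<otimes> z) < e}"
  have "\<not> (L (inv x \<otimes> z) < e \<and> L (inv y \<otimes> z) < e)" if z: "z \<in> carrier G" for z
    using length_diff_triangle[OF x z y] length_diff_commute[OF y z] unfolding e_def by linarith
  then have "disjnt ?U ?V" by (auto simp: disjnt_def)
  then show "\<exists>U V. openin (length_topology G L) U \<and> openin (length_topology G L) V \<and>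
      x \<in> U \<and> y \<in> V \<and> disjnt U V"
    using openin_length_ball[OF x, of e] openin_length_ball[OF y, of e] x y e
    by (intro exI[of _ ?U] exI[of _ ?V]) (simp add: length_one)
qed

text \<open>
  The metric \<open>L(x\<^sup>-\<^sup>1 y)\<close> is left-invariant, so left translations are harmless; continuity of
  multiplication and inversion only needs that conjugations do not enlarge small elements
  too much, as \<open>(xy)\<^sup>-\<^sup>1(x'y') = y\<^sup>-\<^sup>1(x\<^sup>-\<^sup>1x')y \<cdot> y\<^sup>-\<^sup>1y'\<close> and \<open>x x'\<^sup>-\<^sup>1 = x(x'\<^sup>-\<^sup>1x)x\<^sup>-\<^sup>1\<close> show.
\<close>

lemma group_topology_length_topology:
  assumes conj: "\<And>p e. p \<in> carrier G \<Longrightarrow> 0 < e \<Longrightarrow>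
      \<exists>d>0. \<forall>q\<in>carrier G. L q < d \<longrightarrow> L (p \<otimes> q \<otimes> inv p) < e"
  shows "group_topology G (length_topology G L)"
proof -
  let ?T = "length_topology G L"
  have mult: "continuous_map (prod_topology ?T ?T) ?T (\<lambda>(x, y). x \<otimes> y)"
    unfolding continuous_map_def
  proof (intro conjI allI impI)
    show "(\<lambda>(x, y). x \<otimes> y) \<in> topspace (prod_topology ?T ?T) \<rightarrow> topspace ?T" by auto
    fix U assume U: "openin ?T U"
    show "openin (prod_topology ?T ?T) {z \<in> topspace (prod_topology ?T ?T). (\<lambda>(x, y). x \<otimes> y) z \<in> U}"
    proof (subst openin_subopen, intro ballI)
      fix u assume "u \<in> {z \<in> topspace (prod_topology ?T ?T). (\<lambda>(x, y). x \<otimes> y) z \<in> U}"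
      then obtain x y where u: "u = (x, y)" and x: "x \<in> carrier G" and y: "y \<in> carrier G" and xy: "x \<otimes> y \<in> U"
        by auto
      obtain e where e: "e > 0" "\<And>z. z \<in> carrier G \<Longrightarrow> L (inv (x \<otimes> y) \<otimes> z) < e \<Longrightarrow> z \<in> U"
        using U xy by (auto simp: openin_length_topology)
      obtain d where d: "d > 0" "\<And>q. q \<in> carrier G \<Longrightarrow> L q < d \<Longrightarrow> L (inv y \<otimes> q \<otimes> y) < e/2"
        using conj[of "inv y" "e/2"] y e by auto
      let ?V = "{z \<in> carrier G. L (inv x \<otimes> z) < d} \<times> {z \<in> carrier G. L (inv y \<otimes> z) < e/2}"
      have "x' \<otimes> y' \<in> U" if x': "x' \<in> carrier G" "L (inv x \<otimes> x') < d"
        and y': "y' \<in> carrier G" "L (inv y \<otimes> y') < e/2" for x' y'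
      proof (rule e(2))
        have "inv (x \<otimes> y) \<otimes> (x' \<otimes> y') = (inv y \<otimes> (inv x \<otimes> x') \<otimes> y) \<otimes> (inv y \<otimes> y')"
          using x y x' y' by (simp add: inv_mult_group m_assoc mult_inv_cancel_left)
        then have "L (inv (x \<otimes> y) \<otimes> (x' \<otimes> y')) \<le> L (inv y \<otimes> (inv x \<otimes> x') \<otimes> y) + L (inv y \<otimes> y')"
          using x y x' y' by (simp add: length_mult)
        then show "L (inv (x \<otimes> y) \<otimes> (x' \<otimes> y')) < e"
          using d(2)[of "inv x \<otimes> x'"] x y x' y' by simp
      qed (use x' y' in simp)
      then show "\<exists>V. openin (prod_topology ?T ?T) V \<and> u \<in> V \<and>
          V \<subseteq> {z \<in> topspace (prod_topology ?T ?T). (\<lambda>(x, y). x \<otimes> y) z \<in> U}"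
        using x y e d openin_length_ball[OF x, of d] openin_length_ball[OF y, of "e/2"]
        by (intro exI[of _ ?V]) (simp add: u openin_prod_Times_iff length_one, auto)
    qed
  qed
  have inv: "continuous_map ?T ?T (\<lambda>x. inv x)"
    unfolding continuous_map_def
  proof (intro conjI allI impI)
    fix U assume U: "openin ?T U"
    show "openin ?T {x \<in> topspace ?T. inv x \<in> U}"
      unfolding openin_length_topology[of G L "{x \<in> topspace ?T. inv x \<in> U}"]
    proof (intro conjI ballI)
      fix x assume "x \<in> {x \<in> topspace ?T. inv x \<in> U}"
      then have x: "x \<in> carrier G" and xU: "inv x \<in> U" by auto
      obtain e where e: "e > 0" "\<And>z. z \<in> carrier G \<Longrightarrow> L (inv (inv x) \<otimes> z) < e \<Longrightarrow> z \<in> U"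
        using U xU unfolding openin_length_topology by blast
      obtain d where d: "d > 0" "\<And>q. q \<in> carrier G \<Longrightarrow> L q < d \<Longrightarrow> L (x \<otimes> q \<otimes> inv x) < e"
        using conj[of x e] x e by auto
      have "inv y \<in> U" if y: "y \<in> carrier G" "L (inv x \<otimes> y) < d" for y
      proof (rule e(2))
        have "inv (inv x) \<otimes> inv y = x \<otimes> (inv y \<otimes> x) \<otimes> inv x"
          using x y by (simp add: m_assoc)
        then show "L (inv (inv x) \<otimes> inv y) < e"
          using d(2)[of "inv y \<otimes> x"] x y by (simp add: length_diff_commute)
      qed (use y in simp)
      then show "\<exists>d>0. \<forall>y\<in>carrier G. L (inv x \<otimes> y) < d \<longrightarrow> y \<in> {x \<in> topspace ?T. inv x \<in> U}"
        using d by auto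
    qed auto
  qed auto
  show ?thesis
    using mult inv is_group by (simp add: group_topology_def)
qed

end

lemma length_topology_subgroup:
  assumes H: "group_length G L" and K: "group K"
    and sub: "carrier K \<subseteq> carrier G"
    and mult: "\<And>x y. x \<in> carrier K \<Longrightarrow> y \<in> carrier K \<Longrightarrow> x \<otimes>\<^bsub>K\<^esub> y = x \<otimes>\<^bsub>G\<^esub> y"
    and NL: "\<And>x. x \<in> carrier K \<Longrightarrow> N x = L x"
  shows "subtopology (length_topology G L) (carrier K) = length_topology K N"
proof -
  interpret G: group_length G L by fact
  interpret K: group K by fact
  have one: "\<one>\<^bsub>K\<^esub> = \<one>\<^bsub>G\<^esub>"
    using mult[of "\<one>\<^bsub>K\<^esub>" "\<one>\<^bsub>K\<^esub>"] subsetD[OF sub K.one_closed] G.l_cancel_one[of "\<one>\<^bsub>K\<^esub>" "\<one>\<^bsub>K\<^esub>"] by simp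
  have inv: "inv\<^bsub>K\<^esub> x = inv\<^bsub>G\<^esub> x" if "x \<in> carrier K" for x
    using G.inv_equality[of "inv\<^bsub>K\<^esub> x" x] mult[of "inv\<^bsub>K\<^esub> x" x] that subsetD[OF sub, of x]
      subsetD[OF sub, of "inv\<^bsub>K\<^esub> x"] one by simp
  have eq: "N (inv\<^bsub>K\<^esub> x \<otimes>\<^bsub>K\<^esub> y) = L (inv\<^bsub>G\<^esub> x \<otimes>\<^bsub>G\<^esub> y)" if "x \<in> carrier K" "y \<in> carrier K" for x y
  proof -
    have "inv\<^bsub>K\<^esub> x \<in> carrier K" using that by simp
    then show ?thesis
      using NL[of "inv\<^bsub>K\<^esub> x \<otimes>\<^bsub>K\<^esub> y"] mult[of "inv\<^bsub>K\<^esub> x" y] that inv[of x] by simp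
  qed
  show ?thesis
    unfolding topology_eq
  proof (intro allI iffI)
    fix U assume "openin (subtopology (length_topology G L) (carrier K)) U"
    then obtain V where V: "openin (length_topology G L) V" "U = V \<inter> carrier K"
      by (auto simp: openin_subtopology)
    then show "openin (length_topology K N) U"
      unfolding openin_length_topology
    proof (intro conjI ballI)
      fix x assume "x \<in> U"
      then have x: "x \<in> V" "x \<in> carrier K" using V by auto
      then obtain e where "e > 0" "\<forall>y\<in>carrier G. L (inv\<^bsub>G\<^esub> x \<otimes>\<^bsub>G\<^esub> y) < e \<longrightarrow> y \<in> V"
        using V unfolding openin_length_topology by blast
      then show "\<exists>e>0. \<forall>y\<in>carrier K. N (inv\<^bsub>K\<^esub> x \<otimes>\<^bsub>K\<^esub> y) < e \<longrightarrow> y \<in> U"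
        using x sub eq V(2) by (intro exI[of _ e]) auto
    qed (use V in auto)
  next
    fix U assume U: "openin (length_topology K N) U"
    then have UK: "U \<subseteq> carrier K" by (simp add: openin_length_topology)
    obtain e where e: "\<And>x. x \<in> U \<Longrightarrow> e x > 0"
        "\<And>x y. x \<in> U \<Longrightarrow> y \<in> carrier K \<Longrightarrow> N (inv\<^bsub>K\<^esub> x \<otimes>\<^bsub>K\<^esub> y) < e x \<Longrightarrow> y \<in> U"
      using U unfolding openin_length_topology by metis
    define V where "V = (\<Union>x\<in>U. {y \<in> carrier G. L (inv\<^bsub>G\<^esub> x \<otimes>\<^bsub>G\<^esub> y) < e x})"
    have "openin (length_topology G L) V"
      unfolding V_def
    proof (rule openin_Union, safe)
      fix x assume "x \<in> U"
      then have "x \<in> carrier G" using UK sub by blast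
      then show "openin (length_topology G L) {y \<in> carrier G. L (inv\<^bsub>G\<^esub> x \<otimes>\<^bsub>G\<^esub> y) < e x}"
        by (rule G.openin_length_ball)
    qed
    moreover have "U = V \<inter> carrier K"
    proof
      show "U \<subseteq> V \<inter> carrier K"
      proof
        fix x assume x: "x \<in> U"
        then have "x \<in> carrier G" "x \<in> carrier K" using UK sub by auto
        then show "x \<in> V \<inter> carrier K"
          using x e(1)[OF x] unfolding V_def by (auto intro!: bexI[of _ x] simp: G.length_one)
      qed
      show "V \<inter> carrier K \<subseteq> U"
      proof
        fix y assume "y \<in> V \<inter> carrier K"
        then obtain x where "x \<in> U" "y \<in> carrier K" "L (inv\<^bsub>G\<^esub> x \<otimes>\<^bsub>G\<^esub> y) < e x"
          unfolding V_def by auto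
        then show "y \<in> U"
          using e(2)[of x y] eq[of x y] UK by auto
      qed
    qed
    ultimately show "openin (subtopology (length_topology G L) (carrier K)) U"
      by (auto simp: openin_subtopology)
  qed
qed

section \<open>Lengths as infima of costs of factorizations\<close>

definition word_prod :: "('a, 'b) monoid_scheme \<Rightarrow> ('a \<times> real) list \<Rightarrow> 'a" where
  "word_prod G l = foldr (\<lambda>a x. fst a \<otimes>\<^bsub>G\<^esub> x) l \<one>\<^bsub>G\<^esub>"

definition word_cost :: "('a \<times> real) list \<Rightarrow> real" where
  "word_cost l = sum_list (map snd l)"

lemma word_prod_simps [simp]:
  "word_prod G [] = \<one>\<^bsub>G\<^esub>" "word_prod G (a # l) = fst a \<otimes>\<^bsub>G\<^esub> word_prod G l"
  by (simp_all add: word_prod_def)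

lemma word_cost_simps [simp]:
  "word_cost [] = 0" "word_cost (a # l) = snd a + word_cost l" "word_cost (l @ l') = word_cost l + word_cost l'"
  by (simp_all add: word_cost_def)

text \<open>
  The largest length function bounded by \<open>1\<close> and by the weight \<open>r\<close> at \<open>a\<close> for each pair
  \<open>(a, r)\<close> in \<open>C\<close>. The cap \<open>1\<close> gives a value to elements that are not products of weighted ones.
\<close>

definition weighted_length :: "('a, 'b) monoid_scheme \<Rightarrow> ('a \<times> real) set \<Rightarrow> 'a \<Rightarrow> real" where
  "weighted_length G C p = Inf (insert 1 {word_cost l | l. l \<in> lists C \<and> word_prod G l = p})"

locale weighted_group = group G for G (structure) +
  fixes C :: "('a \<times> real) set"
  assumes weighted_carrier: "(a, r) \<in> C \<Longrightarrow> a \<in> carrier G"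
    and weight_nonneg: "(a, r) \<in> C \<Longrightarrow> 0 \<le> r"
    and weighted_inv: "(a, r) \<in> C \<Longrightarrow> (inv a, r) \<in> C"
begin

lemma word_prod_closed: "l \<in> lists C \<Longrightarrow> word_prod G l \<in> carrier G"
  by (induction l) (auto simp: weighted_carrier)

lemma word_prod_append:
  "l \<in> lists C \<Longrightarrow> l' \<in> lists C \<Longrightarrow> word_prod G (l @ l') = word_prod G l \<otimes> word_prod G l'"
proof (induction l)
  case (Cons a l)
  then have "(fst a, snd a) \<in> C" "l \<in> lists C" by auto
  then show ?case
    using Cons word_prod_closed[of l] word_prod_closed[of l'] weighted_carrier[of "fst a" "snd a"]
    by (simp add: m_assoc)
qed (simp add: word_prod_closed)

lemma word_cost_nonneg: "l \<in> lists C \<Longrightarrow> 0 \<le> word_cost l"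
  by (induction l) (auto dest: weight_nonneg)

lemma word_inv:
  assumes "l \<in> lists C"
  shows "\<exists>l'\<in>lists C. word_prod G l' = inv (word_prod G l) \<and> word_cost l' = word_cost l"
  using assms
proof (induction l rule: lists.induct)
  case Nil
  show ?case by (rule bexI[of _ "[]"]) auto
next
  case (Cons a l)
  obtain x r where a: "a = (x, r)" by fastforce
  have x: "(x, r) \<in> C" and l: "l \<in> lists C" using Cons.hyps by (simp_all add: a)
  obtain l' where l': "l' \<in> lists C" "word_prod G l' = inv (word_prod G l)" "word_cost l' = word_cost l"
    using Cons.IH by auto
  have one: "[(inv x, r)] \<in> lists C" using weighted_inv[OF x] by simp
  have "word_prod G (l' @ [(inv x, r)]) = inv (word_prod G (a # l))"
    using word_prod_append[OF l'(1) one] l' word_prod_closed[OF l] weighted_carrier[OF x]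
    by (simp add: a inv_mult_group)
  then show ?case
    using l' one by (intro bexI[of _ "l' @ [(inv x, r)]"]) (auto simp: a)
qed

lemma word_conj:
  assumes u: "u \<in> carrier G" and conj: "\<And>a r. (a, r) \<in> C \<Longrightarrow> (u \<otimes> a \<otimes> inv u, r) \<in> C"
    and "l \<in> lists C"
  shows "\<exists>l'\<in>lists C. word_prod G l' = u \<otimes> word_prod G l \<otimes> inv u \<and> word_cost l' = word_cost l"
  using \<open>l \<in> lists C\<close>
proof (induction l rule: lists.induct)
  case Nil
  show ?case by (rule bexI[of _ "[]"]) (use u in auto)
next
  case (Cons a l)
  obtain x r where a: "a = (x, r)" by fastforce
  have x: "(x, r) \<in> C" and l: "l \<in> lists C" using Cons.hyps by (simp_all add: a)
  obtain l' where l': "l' \<in> lists C" "word_prod G l' = u \<otimes> word_prod G l \<otimes> inv u" "word_cost l' = word_cost l"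
    using Cons.IH by auto
  have "word_prod G ((u \<otimes> x \<otimes> inv u, r) # l') = u \<otimes> word_prod G (a # l) \<otimes> inv u"
    using l' word_prod_closed[OF l] weighted_carrier[OF x] u
    by (simp add: a m_assoc mult_inv_cancel_left)
  then show ?case
    using l' conj[OF x] by (intro bexI[of _ "(u \<otimes> x \<otimes> inv u, r) # l'"]) (auto simp: a)
qed

lemma weighted_length_lower:
  assumes "\<And>l. l \<in> lists C \<Longrightarrow> word_prod G l = p \<Longrightarrow> m \<le> word_cost l" "m \<le> 1"
  shows "m \<le> weighted_length G C p"
  unfolding weighted_length_def by (rule cInf_greatest) (use assms in auto)

lemma weighted_length_bdd_below:
  "bdd_below (insert 1 {word_cost l | l. l \<in> lists C \<and> word_prod G l = p})"
  using word_cost_nonneg by (intro bdd_belowI[of _ 0]) auto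

lemma weighted_length_le_cost: "l \<in> lists C \<Longrightarrow> weighted_length G C (word_prod G l) \<le> word_cost l"
  unfolding weighted_length_def by (rule cInf_lower[OF _ weighted_length_bdd_below]) auto

lemma weighted_length_le_one: "weighted_length G C p \<le> 1"
  unfolding weighted_length_def by (rule cInf_lower[OF _ weighted_length_bdd_below]) auto

lemma weighted_length_le_weight: "(a, r) \<in> C \<Longrightarrow> weighted_length G C a \<le> r"
  using weighted_length_le_cost[of "[(a, r)]"] weighted_carrier[of a r] by simp

lemma weighted_length_nonneg: "0 \<le> weighted_length G C p"
  by (rule weighted_length_lower) (auto simp: word_cost_nonneg)

lemma weighted_length_less:
  assumes "weighted_length G C p < e" "e \<le> 1"
  shows "\<exists>l\<in>lists C. word_prod G l = p \<and> word_cost l < e"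
proof -
  have "\<exists>x\<in>insert 1 {word_cost l | l. l \<in> lists C \<and> word_prod G l = p}. x < e"
    using assms(1) unfolding weighted_length_def
    by (subst (asm) cInf_less_iff[OF _ weighted_length_bdd_below]) auto
  then show ?thesis using assms(2) by auto
qed

sublocale group_length G "weighted_length G C"
proof
  show "weighted_length G C \<one> = 0"
    using weighted_length_le_cost[of "[]"] weighted_length_nonneg[of \<one>] by simp
  show "weighted_length G C (inv x) = weighted_length G C x" if "x \<in> carrier G" for x
  proof -
    have le: "weighted_length G C (inv y) \<le> weighted_length G C y" if "y \<in> carrier G" for y
    proof (rule weighted_length_lower[OF _ weighted_length_le_one])
      fix l assume "l \<in> lists C" "word_prod G l = y"
      then show "weighted_length G C (inv y) \<le> word_cost l"
        using word_inv[of l] weighted_length_le_cost by fastforce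
    qed
    show ?thesis using le[of x] le[of "inv x"] that by simp
  qed
  fix x y assume "x \<in> carrier G" "y \<in> carrier G"
  have "weighted_length G C (x \<otimes> y) - weighted_length G C y \<le> weighted_length G C x"
  proof (rule weighted_length_lower)
    show "weighted_length G C (x \<otimes> y) - weighted_length G C y \<le> 1"
      using weighted_length_le_one[of "x \<otimes> y"] weighted_length_nonneg[of y] by linarith
    fix l assume l: "l \<in> lists C" "word_prod G l = x"
    have "weighted_length G C (x \<otimes> y) - word_cost l \<le> weighted_length G C y"
    proof (rule weighted_length_lower)
      show "weighted_length G C (x \<otimes> y) - word_cost l \<le> 1"
        using weighted_length_le_one[of "x \<otimes> y"] word_cost_nonneg[OF l(1)] by linarith
      fix l' assume l': "l' \<in> lists C" "word_prod G l' = y"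
      have "weighted_length G C (word_prod G (l @ l')) \<le> word_cost (l @ l')"
        using l(1) l'(1) by (intro weighted_length_le_cost) auto
      then show "weighted_length G C (x \<otimes> y) - word_cost l \<le> word_cost l'"
        using word_prod_append[OF l(1) l'(1)] l(2) l'(2) by simp
    qed
    then show "weighted_length G C (x \<otimes> y) - weighted_length G C y \<le> word_cost l"
      by linarith
  qed
  then show "weighted_length G C (x \<otimes> y) \<le> weighted_length G C x + weighted_length G C y"
    by linarith
qed (rule weighted_length_nonneg)

lemma weighted_length_conj:
  assumes conj: "\<And>u a r. u \<in> carrier G \<Longrightarrow> (a, r) \<in> C \<Longrightarrow> (u \<otimes> a \<otimes> inv u, r) \<in> C"
    and u: "u \<in> carrier G" and x: "x \<in> carrier G"
  shows "weighted_length G C (u \<otimes> x \<otimes> inv u) = weighted_length G C x"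
proof -
  have le: "weighted_length G C (v \<otimes> y \<otimes> inv v) \<le> weighted_length G C y"
    if v: "v \<in> carrier G" for v y
  proof (rule weighted_length_lower[OF _ weighted_length_le_one])
    fix l assume l: "l \<in> lists C" "word_prod G l = y"
    then obtain l' where "l' \<in> lists C" "word_prod G l' = v \<otimes> y \<otimes> inv v" "word_cost l' = word_cost l"
      using word_conj[OF v conj[OF v] l(1)] by auto
    then show "weighted_length G C (v \<otimes> y \<otimes> inv v) \<le> word_cost l"
      using weighted_length_le_cost[of l'] by simp
  qed
  have "inv u \<otimes> (u \<otimes> x \<otimes> inv u) \<otimes> inv (inv u) = x"
    using u x by (simp add: m_assoc mult_inv_cancel_left)
  then show ?thesis
    using le[OF u, of x] le[of "inv u" "u \<otimes> x \<otimes> inv u"] u by simp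
qed

end

text \<open>
  Some letter of a word straddles the point at which the accumulated cost reaches \<open>t\<close>.
\<close>

lemma split_at_cost:
  assumes "\<And>a. a \<in> set l \<Longrightarrow> 0 \<le> snd a" "0 \<le> t" "t \<le> word_cost l" "l \<noteq> []"
  shows "\<exists>l1 a l2. l = l1 @ a # l2 \<and> word_cost l1 \<le> t \<and> t \<le> word_cost l1 + snd a"
  using assms
proof (induction l arbitrary: t)
  case (Cons a l)
  show ?case
  proof (cases "t \<le> snd a")
    case True
    then show ?thesis using Cons.prems by (intro exI[of _ "[]"]) auto
  next
    case False
    then have "l \<noteq> []" using Cons.prems by auto
    then have "\<exists>l1 b l2. l = l1 @ b # l2 \<and> word_cost l1 \<le> t - snd a \<and> t - snd a \<le> word_cost l1 + snd b"
      using Cons.prems False by (intro Cons.IH) auto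
    then obtain l1 b l2 where "l = l1 @ b # l2" "word_cost l1 \<le> t - snd a" "t - snd a \<le> word_cost l1 + snd b"
      by blast
    then show ?thesis by (intro exI[of _ "a # l1"] exI[of _ b] exI[of _ l2]) auto
  qed
qed simp

text \<open>
  This is why sums of dyadic weights detect the neighbourhoods \<open>U n\<close>: cut the word at half of
  its total cost. The parts before and after the letter at the cut cost less than
  \<open>(1/2)^(n+1)\<close> each and lie in \<open>U (n+1)\<close> by induction; the letter itself costs less than
  \<open>(1/2)^n\<close> and so also lies in \<open>U (n+1)\<close>; three elements of \<open>U (n+1)\<close> multiply into \<open>U n\<close>.
\<close>

lemma (in group) dyadic_chain:
  fixes U :: "nat \<Rightarrow> 'a set"
  assumes one: "\<And>n. \<one> \<in> U n" and carrier: "\<And>n. U n \<subseteq> carrier G"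
    and cube: "\<And>n x y z. x \<in> U (Suc n) \<Longrightarrow> y \<in> U (Suc n) \<Longrightarrow> z \<in> U (Suc n) \<Longrightarrow> x \<otimes> (y \<otimes> z) \<in> U n"
    and inv: "\<And>n x. x \<in> U n \<Longrightarrow> inv x \<in> U n"
    and l: "l \<in> lists {(x, (1/2)^n) | x n. x \<in> U n}" and "word_cost l < (1/2)^n"
  shows "word_prod G l \<in> U n"
  using l \<open>word_cost l < (1/2)^n\<close>
proof (induction l arbitrary: n rule: length_induct)
  case (1 l)
  let ?C = "{(x, (1/2)^n) | x n. x \<in> U n} :: ('a \<times> real) set"
  have decreasing: "U n \<subseteq> U m" if "m \<le> n" for m n
  proof (rule lift_Suc_antimono_le[OF _ that])
    show "U (Suc n) \<subseteq> U n" for n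
    proof
      fix x assume "x \<in> U (Suc n)"
      then show "x \<in> U n"
        using cube[of x n \<one> \<one>] one[of "Suc n"] carrier[of "Suc n"] by auto
    qed
  qed
  interpret weighted_group G ?C
    using carrier inv by unfold_locales auto
  show ?case
  proof (cases "l = []")
    case True
    then show ?thesis by (simp add: one)
  next
    case False
    have pos: "0 \<le> snd a" if "a \<in> set l" for a
      using that "1.prems"(1) by auto
    have "0 \<le> word_cost l" by (rule word_cost_nonneg) fact
    then have "\<exists>l1 a l2. l = l1 @ a # l2 \<and> word_cost l1 \<le> word_cost l / 2 \<and>
        word_cost l / 2 \<le> word_cost l1 + snd a"
      by (intro split_at_cost pos False) auto
    then obtain l1 a l2 where l: "l = l1 @ a # l2" "word_cost l1 \<le> word_cost l / 2"
        "word_cost l / 2 \<le> word_cost l1 + snd a"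
      by blast
    have mem: "l1 \<in> lists ?C" "a \<in> ?C" "l2 \<in> lists ?C" using "1.prems"(1) l(1) by auto
    then obtain x k where a: "a = (x, (1/2)^k)" "x \<in> U k" by auto
    have nonneg: "0 \<le> word_cost l1" "0 \<le> word_cost l2"
      using mem by (auto intro: word_cost_nonneg)
    have half: "word_cost l1 < (1/2)^Suc n" "word_cost l2 < (1/2)^Suc n"
      using l "1.prems"(2) by auto
    have "(1/2)^k \<le> word_cost l"
      using nonneg by (simp add: l(1) a(1))
    then have "(1/2)^k < (1/2 :: real)^n"
      using "1.prems"(2) by (rule order.strict_trans1)
    then have "\<not> k \<le> n"
      using power_decreasing[of k n "1/2 :: real"] by auto
    then have "Suc n \<le> k" by simp
    then have x: "x \<in> U (Suc n)" using a(2) decreasing by blast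
    have "word_prod G l1 \<in> U (Suc n)" "word_prod G l2 \<in> U (Suc n)"
      using "1.IH" mem half l(1) by auto
    then have "word_prod G l1 \<otimes> (x \<otimes> word_prod G l2) \<in> U n"
      using cube x by blast
    moreover have "a # l2 \<in> lists ?C" using mem by auto
    ultimately show ?thesis
      using word_prod_append[OF mem(1), of "a # l2"] by (simp add: l(1) a(1))
  qed
qed

section \<open>Metrizable group topologies come from lengths\<close>

lemma identity_neighbourhood_cube:
  assumes T: "group_topology G T" and U: "openin T U" "\<one>\<^bsub>G\<^esub> \<in> U"
  shows "\<exists>W. openin T W \<and> \<one>\<^bsub>G\<^esub> \<in> W \<and> (\<forall>x\<in>W. inv\<^bsub>G\<^esub> x \<in> W) \<and>
    (\<forall>x\<in>W. \<forall>y\<in>W. \<forall>z\<in>W. x \<otimes>\<^bsub>G\<^esub> (y \<otimes>\<^bsub>G\<^esub> z) \<in> U)"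
proof -
  interpret group G using T by (simp add: group_topology_def)
  have top: "topspace T = carrier G"
    and mult: "continuous_map (prod_topology T T) T (\<lambda>(x, y). x \<otimes>\<^bsub>G\<^esub> y)"
    and inv: "continuous_map T T (\<lambda>x. inv\<^bsub>G\<^esub> x)"
    using T by (auto simp: group_topology_def)
  have square: "\<exists>W. openin T W \<and> \<one>\<^bsub>G\<^esub> \<in> W \<and> (\<forall>x\<in>W. \<forall>y\<in>W. x \<otimes>\<^bsub>G\<^esub> y \<in> V)"
    if V: "openin T V" "\<one>\<^bsub>G\<^esub> \<in> V" for V
  proof -
    let ?P = "{z \<in> topspace (prod_topology T T). (\<lambda>(x, y). x \<otimes>\<^bsub>G\<^esub> y) z \<in> V}"
    have P: "openin (prod_topology T T) ?P"
      using mult V(1) by (rule openin_continuous_map_preimage)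
    have "(\<one>\<^bsub>G\<^esub>, \<one>\<^bsub>G\<^esub>) \<in> ?P" using V(2) by (simp add: top)
    from iffD1[OF openin_prod_topology_alt P, rule_format, OF this]
    obtain A B where AB: "openin T A" "openin T B" "\<one>\<^bsub>G\<^esub> \<in> A" "\<one>\<^bsub>G\<^esub> \<in> B" "A \<times> B \<subseteq> ?P"
      by blast
    have "x \<otimes>\<^bsub>G\<^esub> y \<in> V" if "x \<in> A \<inter> B" "y \<in> A \<inter> B" for x y
      using subsetD[OF AB(5), of "(x, y)"] that by simp
    then show ?thesis
      using AB by (intro exI[of _ "A \<inter> B"]) (simp add: openin_Int)
  qed
  obtain V where V: "openin T V" "\<one>\<^bsub>G\<^esub> \<in> V" "\<And>x y. x \<in> V \<Longrightarrow> y \<in> V \<Longrightarrow> x \<otimes>\<^bsub>G\<^esub> y \<in> U"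
    using square[OF U] by blast
  obtain W where W: "openin T W" "\<one>\<^bsub>G\<^esub> \<in> W" "\<And>x y. x \<in> W \<Longrightarrow> y \<in> W \<Longrightarrow> x \<otimes>\<^bsub>G\<^esub> y \<in> V"
    using square[OF V(1,2)] by blast
  have W_carrier: "W \<subseteq> carrier G" using openin_subset[OF W(1)] top by simp
  have WV: "x \<in> V" if "x \<in> W" for x
  proof -
    have "x \<otimes>\<^bsub>G\<^esub> \<one>\<^bsub>G\<^esub> \<in> V" using W that by blast
    then show ?thesis using W_carrier that by auto
  qed
  let ?W = "W \<inter> {x \<in> topspace T. inv\<^bsub>G\<^esub> x \<in> W}"
  have "openin T {x \<in> topspace T. inv\<^bsub>G\<^esub> x \<in> W}"
    using inv W(1) by (rule openin_continuous_map_preimage)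
  then have "openin T ?W" using W(1) by (rule openin_Int[rotated])
  moreover have "inv\<^bsub>G\<^esub> x \<in> ?W" if "x \<in> ?W" for x
    using that W_carrier top by auto
  moreover have "x \<otimes>\<^bsub>G\<^esub> (y \<otimes>\<^bsub>G\<^esub> z) \<in> U" if "x \<in> ?W" "y \<in> ?W" "z \<in> ?W" for x y z
    using that V(3) W(3) WV by simp
  moreover have "\<one>\<^bsub>G\<^esub> \<in> ?W" using W(2) top by simp
  ultimately show ?thesis by (intro exI[of _ ?W]) simp
qed

lemma openin_left_translate:
  assumes T: "group_topology G T" and U: "openin T U" and x: "x \<in> carrier G"
  shows "openin T {y \<in> carrier G. x \<otimes>\<^bsub>G\<^esub> y \<in> U}"
proof -
  have "continuous_map T (prod_topology T T) (\<lambda>y. (x, y))"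
    using x T by (intro continuous_map_pairedI) (auto simp: group_topology_def)
  then have "continuous_map T T ((\<lambda>(x, y). x \<otimes>\<^bsub>G\<^esub> y) \<circ> (\<lambda>y. (x, y)))"
    using T unfolding group_topology_def by (blast intro: continuous_map_compose)
  from openin_continuous_map_preimage[OF this U] show ?thesis
    using T by (simp add: group_topology_def)
qed

lemma openin_right_translate:
  assumes T: "group_topology G T" and U: "openin T U" and x: "x \<in> carrier G"
  shows "openin T {y \<in> carrier G. y \<otimes>\<^bsub>G\<^esub> x \<in> U}"
proof -
  have "continuous_map T (prod_topology T T) (\<lambda>y. (y, x))"
    using x T by (intro continuous_map_pairedI) (auto simp: group_topology_def)
  then have "continuous_map T T ((\<lambda>(x, y). x \<otimes>\<^bsub>G\<^esub> y) \<circ> (\<lambda>y. (y, x)))"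
    using T unfolding group_topology_def by (blast intro: continuous_map_compose)
  from openin_continuous_map_preimage[OF this U] show ?thesis
    using T by (simp add: group_topology_def)
qed

text \<open>
  Choose symmetric open neighbourhoods \<open>U n\<close> of the identity that shrink to it and satisfy
  \<open>U (n+1)\<^sup>3 \<subseteq> U n\<close>, and give the elements of \<open>U n\<close> the weight \<open>(1/2)^n\<close>. The resulting length is at
  most \<open>(1/2)^n\<close> on \<open>U n\<close>, and by \<open>dyadic_chain\<close> its ball of radius \<open>(1/2)^n\<close> lies in \<open>U n\<close>,
  so its balls and the \<open>U n\<close> are the same neighbourhoods of the identity.
\<close>

theorem Birkhoff_Kakutani:
  assumes T: "group_topology G T" and metrizable: "metrizable_space T"
  shows "\<exists>N. group_length G N \<and> (\<forall>x\<in>carrier G. N x = 0 \<longrightarrow> x = \<one>\<^bsub>G\<^esub>) \<and>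
    (\<forall>p\<in>carrier G. \<forall>e>0. \<exists>d>0. \<forall>q\<in>carrier G. N q < d \<longrightarrow> N (p \<otimes>\<^bsub>G\<^esub> q \<otimes>\<^bsub>G\<^esub> inv\<^bsub>G\<^esub> p) < e) \<and>
    length_topology G N = T"
proof -
  interpret group G using T by (simp add: group_topology_def)
  have top: "topspace T = carrier G" using T by (simp add: group_topology_def)
  obtain M m where "Metric_space M m" and T_eq: "T = Metric_space.mtopology M m"
    using metrizable unfolding metrizable_space_def by blast
  then interpret m: Metric_space M m by simp
  have M: "M = carrier G" using top T_eq by simp
  let ?P = "\<lambda>n W. openin T W \<and> \<one>\<^bsub>G\<^esub> \<in> W \<and> (\<forall>x\<in>W. inv\<^bsub>G\<^esub> x \<in> W) \<and>
      W \<subseteq> m.mball \<one>\<^bsub>G\<^esub> (inverse (real (Suc n)))"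
  let ?Q = "\<lambda>V W. \<forall>x\<in>W. \<forall>y\<in>W. \<forall>z\<in>W. x \<otimes>\<^bsub>G\<^esub> (y \<otimes>\<^bsub>G\<^esub> z) \<in> V"
  have "\<exists>U. \<forall>n. ?P n (U n) \<and> ?Q (U n) (U (Suc n))"
  proof (rule dependent_nat_choice)
    have step: "\<exists>W. ?P n W \<and> ?Q U W"
      if U: "openin T U" "\<one>\<^bsub>G\<^esub> \<in> U" for U n
    proof -
      let ?V = "U \<inter> m.mball \<one>\<^bsub>G\<^esub> (inverse (real (Suc n)))"
      have V: "openin T ?V"
        using U(1) unfolding T_eq by (rule openin_Int[OF _ m.openin_mball])
      have V': "\<one>\<^bsub>G\<^esub> \<in> ?V"
        using U(2) M m.centre_in_mball_iff[of "\<one>\<^bsub>G\<^esub>" "inverse (real (Suc n))"] by simp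
      obtain W where W: "openin T W" "\<one>\<^bsub>G\<^esub> \<in> W" "\<forall>x\<in>W. inv\<^bsub>G\<^esub> x \<in> W"
          "\<forall>x\<in>W. \<forall>y\<in>W. \<forall>z\<in>W. x \<otimes>\<^bsub>G\<^esub> (y \<otimes>\<^bsub>G\<^esub> z) \<in> ?V"
        using identity_neighbourhood_cube[OF T V V'] by blast
      have "x \<in> ?V" if x: "x \<in> W" for x
      proof -
        have "x \<otimes>\<^bsub>G\<^esub> (\<one>\<^bsub>G\<^esub> \<otimes>\<^bsub>G\<^esub> \<one>\<^bsub>G\<^esub>) \<in> ?V" using W x by blast
        moreover have "x \<in> carrier G" using openin_subset[OF W(1)] top x by blast
        ultimately show ?thesis by simp
      qed
      then have "W \<subseteq> m.mball \<one>\<^bsub>G\<^esub> (inverse (real (Suc n)))" by blast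
      then show ?thesis using W by (intro exI[of _ W]) blast
    qed
    have "openin T (carrier G)" using openin_topspace[of T] top by simp
    from step[OF this one_closed, of 0]
    show "\<exists>U. ?P 0 U" by blast
    fix U n assume "?P n U"
    then show "\<exists>W. ?P (Suc n) W \<and> ?Q U W"
      using step by blast
  qed
  then obtain U where U: "\<forall>n. ?P n (U n) \<and> ?Q (U n) (U (Suc n))" by (rule exE)
  have U_open: "openin T (U n)" and U_one: "\<one>\<^bsub>G\<^esub> \<in> U n"
    and U_inv: "\<And>x. x \<in> U n \<Longrightarrow> inv\<^bsub>G\<^esub> x \<in> U n"
    and U_ball: "U n \<subseteq> m.mball \<one>\<^bsub>G\<^esub> (inverse (real (Suc n)))"
    and U_cube: "\<And>x y z. x \<in> U (Suc n) \<Longrightarrow> y \<in> U (Suc n) \<Longrightarrow> z \<in> U (Suc n) \<Longrightarrow> x \<otimes>\<^bsub>G\<^esub> (y \<otimes>\<^bsub>G\<^esub> z) \<in> U n" for n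
    using spec[OF U, of n] by blast+
  have U_carrier: "U n \<subseteq> carrier G" for n using openin_subset[OF U_open] top by simp
  have base: "\<exists>n. U n \<subseteq> V" if V: "openin T V" "\<one>\<^bsub>G\<^esub> \<in> V" for V
  proof -
    obtain r where "r > 0" "m.mball \<one>\<^bsub>G\<^esub> r \<subseteq> V"
      using V by (auto simp: T_eq m.openin_mtopology)
    moreover obtain n where "inverse (real (Suc n)) < r"
      using reals_Archimedean[OF \<open>r > 0\<close>] by blast
    ultimately show ?thesis
      using U_ball[of n] m.mball_subset_concentric[of "inverse (real (Suc n))" r "\<one>\<^bsub>G\<^esub>"]
      by (intro exI[of _ n]) (meson less_imp_le subset_trans)
  qed
  let ?C = "{(x, (1/2)^n) | x n. x \<in> U n} :: ('a \<times> real) set"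
  define N where "N = weighted_length G ?C"
  interpret weighted_group G ?C
    using U_carrier U_inv by unfold_locales auto
  have N_less: "x \<in> U n" if x: "N x < (1/2)^n" for x n
  proof -
    have "(1/2)^n \<le> (1 :: real)" by (simp add: power_le_one)
    then obtain l where "l \<in> lists ?C" "word_prod G l = x" "word_cost l < (1/2)^n"
      using weighted_length_less[OF x[unfolded N_def]] by blast
    then show ?thesis
      using dyadic_chain[of U l n] U_one U_carrier U_cube U_inv by blast
  qed
  have N_le: "N x \<le> (1/2)^n" if "x \<in> U n" for x n
    using weighted_length_le_weight[of x "(1/2)^n"] that unfolding N_def by blast
  have U_small: "\<exists>n. \<forall>x\<in>U n. N x < e" if e: "e > 0" for e
  proof -
    obtain n where "(1/2 :: real)^n < e" using real_arch_pow_inv[OF e, of "1/2"] by auto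
    then show ?thesis using N_le by (intro exI[of _ n]) (auto intro: order.strict_trans1)
  qed
  have "x = \<one>\<^bsub>G\<^esub>" if x: "x \<in> carrier G" "N x = 0" for x
  proof (rule ccontr)
    assume "x \<noteq> \<one>\<^bsub>G\<^esub>"
    then have "m \<one>\<^bsub>G\<^esub> x > 0" using x(1) M by (simp add: order_less_le)
    then obtain n where "inverse (real (Suc n)) < m \<one>\<^bsub>G\<^esub> x" using reals_Archimedean by blast
    moreover have "x \<in> U n" using N_less[of x n] x(2) by simp
    ultimately show False using U_ball[of n] by (auto simp: m.in_mball)
  qed
  moreover have "\<exists>d>0. \<forall>q\<in>carrier G. N q < d \<longrightarrow> N (p \<otimes>\<^bsub>G\<^esub> q \<otimes>\<^bsub>G\<^esub> inv\<^bsub>G\<^esub> p) < e"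
    if p: "p \<in> carrier G" and e: "e > 0" for p e
  proof -
    obtain n where n: "\<And>x. x \<in> U n \<Longrightarrow> N x < e" using U_small[OF e] by blast
    let ?V = "{y \<in> carrier G. p \<otimes>\<^bsub>G\<^esub> y \<in> {z \<in> carrier G. z \<otimes>\<^bsub>G\<^esub> inv\<^bsub>G\<^esub> p \<in> U n}}"
    have "openin T ?V"
      using p by (intro openin_left_translate[OF T] openin_right_translate[OF T] U_open) auto
    moreover have "\<one>\<^bsub>G\<^esub> \<in> ?V" using p U_one by simp
    ultimately obtain k where "U k \<subseteq> ?V" using base by blast
    then have "N (p \<otimes>\<^bsub>G\<^esub> q \<otimes>\<^bsub>G\<^esub> inv\<^bsub>G\<^esub> p) < e" if "N q < (1/2)^k" for q
      using n N_less[OF that] by blast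
    then show ?thesis by (intro exI[of _ "(1/2)^k"]) simp
  qed
  moreover have "length_topology G N = T"
    unfolding topology_eq
  proof (intro allI iffI)
    fix V assume V: "openin (length_topology G N) V"
    have "\<exists>W. openin T W \<and> x \<in> W \<and> W \<subseteq> V" if x: "x \<in> V" for x
    proof -
      have xG: "x \<in> carrier G" using V x by (auto simp: openin_length_topology)
      obtain e where e: "e > 0" "\<And>y. y \<in> carrier G \<Longrightarrow> N (inv\<^bsub>G\<^esub> x \<otimes>\<^bsub>G\<^esub> y) < e \<Longrightarrow> y \<in> V"
        using V x unfolding openin_length_topology by blast
      obtain n where n: "\<And>x. x \<in> U n \<Longrightarrow> N x < e" using U_small[OF e(1)] by blast
      let ?W = "{y \<in> carrier G. inv\<^bsub>G\<^esub> x \<otimes>\<^bsub>G\<^esub> y \<in> U n}"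
      have "openin T ?W" using xG by (intro openin_left_translate[OF T U_open]) simp
      moreover have "x \<in> ?W" using xG U_one by simp
      moreover have "?W \<subseteq> V" using e(2) n by blast
      ultimately show ?thesis by blast
    qed
    then show "openin T V" by (subst openin_subopen) blast
  next
    fix V assume V: "openin T V"
    have V_carrier: "V \<subseteq> carrier G" using openin_subset[OF V] top by simp
    have "\<exists>e>0. \<forall>y\<in>carrier G. N (inv\<^bsub>G\<^esub> x \<otimes>\<^bsub>G\<^esub> y) < e \<longrightarrow> y \<in> V" if x: "x \<in> V" for x
    proof -
      have xG: "x \<in> carrier G" using V_carrier x by blast
      have "openin T {y \<in> carrier G. x \<otimes>\<^bsub>G\<^esub> y \<in> V}"
        by (rule openin_left_translate[OF T V xG])
      moreover have "\<one>\<^bsub>G\<^esub> \<in> {y \<in> carrier G. x \<otimes>\<^bsub>G\<^esub> y \<in> V}" using x xG by simp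
      ultimately obtain n where n: "U n \<subseteq> {y \<in> carrier G. x \<otimes>\<^bsub>G\<^esub> y \<in> V}" using base by blast
      have "y \<in> V" if y: "y \<in> carrier G" "N (inv\<^bsub>G\<^esub> x \<otimes>\<^bsub>G\<^esub> y) < (1/2)^n" for y
      proof -
        have "x \<otimes>\<^bsub>G\<^esub> (inv\<^bsub>G\<^esub> x \<otimes>\<^bsub>G\<^esub> y) \<in> V" using N_less[OF y(2)] n by blast
        then show ?thesis using xG y(1) by (simp add: mult_inv_cancel_left)
      qed
      then show ?thesis by (intro exI[of _ "(1/2)^n"]) simp
    qed
    then show "openin (length_topology G N) V"
      using V_carrier by (simp add: openin_length_topology)
  qed
  moreover have "group_length G N" unfolding N_def by (rule group_length_axioms)
  ultimately show ?thesis by (intro exI[of _ N]) blast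
qed

section \<open>Gluing pairs of points in a pseudometric space\<close>

definition pseudometric_on :: "'b set \<Rightarrow> ('b \<Rightarrow> 'b \<Rightarrow> real) \<Rightarrow> bool" where
  "pseudometric_on S d \<longleftrightarrow> (\<forall>x\<in>S. d x x = 0) \<and> (\<forall>x\<in>S. \<forall>y\<in>S. 0 \<le> d x y \<and> d x y = d y x) \<and>
     (\<forall>x\<in>S. \<forall>y\<in>S. \<forall>z\<in>S. d x z \<le> d x y + d y z)"

text \<open>
  The quotient pseudometric after gluing \<open>a\<close> to \<open>b\<close>: a path may use the shortcut once, in
  either direction.
\<close>

definition contract_pair :: "('b \<Rightarrow> 'b \<Rightarrow> real) \<Rightarrow> 'b \<Rightarrow> 'b \<Rightarrow> 'b \<Rightarrow> 'b \<Rightarrow> real" where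
  "contract_pair d a b x y = min (d x y) (min (d x a + d b y) (d x b + d a y))"

lemma pseudometric_contract_pair:
  assumes d: "pseudometric_on S d" and a: "a \<in> S" and b: "b \<in> S"
  shows "pseudometric_on S (contract_pair d a b)"
proof -
  have refl: "d x x = 0" and nonneg: "0 \<le> d x y" and sym: "d x y = d y x"
    and tri: "d x z \<le> d x y + d y z" if "x \<in> S" "y \<in> S" "z \<in> S" for x y z
    using d that unfolding pseudometric_on_def by auto
  have "contract_pair d a b x z \<le> contract_pair d a b x y + contract_pair d a b y z"
    if x: "x \<in> S" and y: "y \<in> S" and z: "z \<in> S" for x y z
    using tri[OF x y z] tri[OF x y a] tri[OF x y b] tri[OF a y z] tri[OF b y z] tri[OF x a z] tri[OF x b z]
      nonneg[OF a y a] nonneg[OF b y b] sym[OF y a a] sym[OF y b b]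
    unfolding contract_pair_def by linarith
  then show ?thesis
    using refl nonneg sym a b unfolding pseudometric_on_def
    by (auto simp: contract_pair_def)
qed

text \<open>
  Gluing the pairs of \<open>ps\<close> one after the other lowers distances by at most the sum of the
  lengths of the pairs, so points at distance at least \<open>e\<close> stay apart. Here \<open>c x\<close> is the class of \<open>x\<close>.
  The last conjunct, that \<open>c\<close> respects points at distance zero, lets the induction glue
  the first pair by passing to the contracted pseudometric.
\<close>

lemma separating_quotient:
  assumes "pseudometric_on S d" and "\<And>a b. (a, b) \<in> set ps \<Longrightarrow> a \<in> S \<and> b \<in> S"
    and "A \<subseteq> S" and "\<And>x y. x \<in> A \<Longrightarrow> y \<in> A \<Longrightarrow> x \<noteq> y \<Longrightarrow> e \<le> d x y"
    and "sum_list (map (\<lambda>(a, b). d a b) ps) < e"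
  shows "\<exists>c :: 'b \<Rightarrow> 'b set. inj_on c A \<and> (\<forall>(a, b) \<in> set ps. c a = c b) \<and>
    (\<forall>x\<in>S. \<forall>y\<in>S. d x y = 0 \<longrightarrow> c x = c y)"
  using assms
proof (induction ps arbitrary: d e)
  case Nil
  let ?c = "\<lambda>x. {z \<in> S. d x z = 0}"
  have refl: "d x x = 0" and nonneg: "0 \<le> d x y" and sym: "d x y = d y x"
    and tri: "d x z \<le> d x y + d y z" if "x \<in> S" "y \<in> S" "z \<in> S" for x y z
    using Nil.prems(1) that unfolding pseudometric_on_def by auto
  have eq: "?c x = ?c y \<longleftrightarrow> d x y = 0" if x: "x \<in> S" and y: "y \<in> S" for x y
  proof
    assume "?c x = ?c y"
    moreover have "y \<in> ?c y" using refl y by simp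
    ultimately show "d x y = 0" by blast
  next
    assume "d x y = 0"
    have "d x z = 0 \<longleftrightarrow> d y z = 0" if z: "z \<in> S" for z
      using tri[OF x y z] tri[OF y x z] nonneg[OF x z z] nonneg[OF y z z] sym[OF x y y] \<open>d x y = 0\<close>
      by linarith
    then show "?c x = ?c y" by blast
  qed
  have "inj_on ?c A"
  proof (rule inj_onI, rule ccontr)
    fix x y assume xy: "x \<in> A" "y \<in> A" "?c x = ?c y" "x \<noteq> y"
    then have "d x y = 0" using eq[of x y] Nil.prems(3) by blast
    then show False using Nil.prems(4)[OF xy(1,2,4)] Nil.prems(5) by simp
  qed
  then show ?case
    by (intro exI[of _ ?c]) (simp add: eq)
next
  case (Cons ab ps)
  obtain a b where ab: "ab = (a, b)" by fastforce
  have a: "a \<in> S" and b: "b \<in> S" using Cons.prems(2) by (auto simp: ab)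
  let ?d = "contract_pair d a b"
  have refl: "d x x = 0" and nonneg: "0 \<le> d x y" and sym: "d x y = d y x"
    and tri: "d x z \<le> d x y + d y z" if "x \<in> S" "y \<in> S" "z \<in> S" for x y z
    using Cons.prems(1) that unfolding pseudometric_on_def by auto
  have lower: "d x y - d a b \<le> ?d x y" if x: "x \<in> S" and y: "y \<in> S" for x y
    using tri[OF x a y] tri[OF a b y] tri[OF x b y] tri[OF b a y] sym[OF a b b] nonneg[OF a b b]
    unfolding contract_pair_def by linarith
  have "sum_list (map (\<lambda>(a, b). ?d a b) ps) \<le> sum_list (map (\<lambda>(a, b). d a b) ps)"
    by (rule sum_list_mono) (auto simp: contract_pair_def)
  then have sum: "sum_list (map (\<lambda>(a, b). ?d a b) ps) < e - d a b"
    using Cons.prems(5) by (simp add: ab)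
  have "e - d a b \<le> ?d x y" if "x \<in> A" "y \<in> A" "x \<noteq> y" for x y
    using Cons.prems(4)[OF that] lower[of x y] that Cons.prems(3) by force
  then obtain c :: "'b \<Rightarrow> 'b set" where c: "inj_on c A" "\<forall>(a, b) \<in> set ps. c a = c b"
      "\<forall>x\<in>S. \<forall>y\<in>S. ?d x y = 0 \<longrightarrow> c x = c y"
    using Cons.IH[OF pseudometric_contract_pair[OF Cons.prems(1) a b] _ Cons.prems(3) _ sum] Cons.prems(2)
    by fastforce
  have "?d x y = 0" if "x \<in> S" "y \<in> S" "d x y = 0" for x y
    using that nonneg a b by (simp add: contract_pair_def)
  moreover have "?d a b = 0"
    using refl nonneg a b by (simp add: contract_pair_def)
  ultimately show ?case
    using c a b by (intro exI[of _ c]) (auto simp: ab)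
qed

section \<open>Rewriting a free word in the basis of the kernel of the retraction\<close>

definition retract_word :: "'a set \<Rightarrow> 'a free_word \<Rightarrow> 'a free_word" where
  "retract_word Z w = reduce_word (filter (\<lambda>a. fst a \<in> Z) w)"

lemma retract_word_Nil [simp]: "retract_word Z [] = []"
  by (simp add: retract_word_def reduce_word_def)

lemma reduce_Cons: "reduce_word (a # w) = cons_letter a (reduce_word w)"
  by (simp add: reduce_word_def)

lemma retract_cons_letter: "retract_word Z (cons_letter a w) = retract_word Z (a # w)"
proof (cases "w = [] \<or> hd w \<noteq> inv_letter a")
  case True
  then show ?thesis by (cases w) auto
next
  case False
  then obtain v where "w = inv_letter a # v" by (cases w) auto
  then show ?thesis
    using cons_letter_cancel[OF reduced_reduce, of a] by (simp add: retract_word_def reduce_Cons)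
qed

lemma retract_reduce_word: "retract_word Z (reduce_word w) = retract_word Z w"
proof (induction w)
  case (Cons a w)
  have "retract_word Z (reduce_word (a # w)) = retract_word Z (a # reduce_word w)"
    by (simp add: reduce_Cons retract_cons_letter)
  also have "\<dots> = retract_word Z (a # w)"
    using Cons.IH by (simp add: retract_word_def reduce_Cons)
  finally show ?case .
qed (simp add: reduce_word_def)

lemma retract_append: "retract_word Z (u @ v) = reduce_word (retract_word Z u @ retract_word Z v)"
  by (simp add: retract_word_def reduce_append_left reduce_append_right)

lemma retract_in_carrier: "retract_word Z w \<in> carrier (free_group Z)"
  using image_mono[OF set_reduce, of fst "filter (\<lambda>a. fst a \<in> Z) w"]
  by (fastforce simp: carrier_free_group retract_word_def reduced_reduce)

lemma retract_of_subgroup: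
  assumes "w \<in> carrier (free_group Z)"
  shows "retract_word Z w = w"
proof -
  have "filter (\<lambda>a. fst a \<in> Z) w = w"
    using assms by (intro filter_True) (auto simp: carrier_free_group)
  then show ?thesis using assms by (simp add: retract_word_def carrier_free_group reduce_reduced)
qed

text \<open>
  Reads \<open>w\<close> from left to right, starting with the element \<open>h\<close> of \<open>F(Z)\<close>. Letters in \<open>Z\<close> are
  multiplied into \<open>h\<close>; a letter \<open>y\<close> outside \<open>Z\<close> emits the symbol \<open>(h, y)\<close>, which stands for
  the kernel element \<open>h y h\<^sup>-\<^sup>1\<close>. For \<open>h = 1\<close> and \<open>w\<close> in the kernel of the retraction this
  is the Reidemeister-Schreier rewriting of \<open>w\<close> in that basis.
\<close>

fun coset_word :: "'a set \<Rightarrow> 'a free_word \<Rightarrow> 'a free_word \<Rightarrow> ('a free_word \<times> 'a) free_word" where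
  "coset_word Z h [] = []"
| "coset_word Z h (a # w) =
     (if fst a \<in> Z then coset_word Z (reduce_word (h @ [a])) w
      else ((h, fst a), snd a) # coset_word Z h w)"

lemma coset_word_append:
  assumes "reduced_word h"
  shows "coset_word Z h (u @ v) =
    coset_word Z h u @ coset_word Z (reduce_word (h @ retract_word Z u)) v"
  using assms
proof (induction u arbitrary: h)
  case (Cons a u)
  show ?case
  proof (cases "fst a \<in> Z")
    case True
    have "reduce_word (reduce_word (h @ [a]) @ retract_word Z u) = reduce_word (h @ retract_word Z (a # u))"
      using True by (simp add: retract_word_def reduce_append_left reduce_append_right)
    then show ?thesis using True Cons.IH[OF reduced_reduce] by simp
  next
    case False
    then show ?thesis using Cons by (simp add: retract_word_def)
  qed
qed (simp add: reduce_reduced)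

lemma coset_word_subgroup: "fst ` set w \<subseteq> Z \<Longrightarrow> coset_word Z h w = []"
  by (induction w arbitrary: h) auto

lemma coset_word_eq_Nil: "coset_word Z h w = [] \<Longrightarrow> fst ` set w \<subseteq> Z"
  by (induction w arbitrary: h) (auto split: if_splits)

lemma coset_word_labels:
  "h \<in> carrier (free_group Z) \<Longrightarrow> fst ` fst ` set (coset_word Z h w) \<subseteq> carrier (free_group Z)"
proof (induction w arbitrary: h)
  case (Cons a w)
  show ?case
  proof (cases "fst a \<in> Z")
    case True
    have "reduce_word (h @ [a]) \<in> carrier (free_group Z)"
      using monoid.m_closed[OF group.is_monoid[OF group_free_group] Cons.prems singleton_in_carrier[OF True]]
      by (simp add: mult_free_group)
    then show ?thesis using Cons.IH True by simp
  next
    case False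
    then show ?thesis using Cons by simp
  qed
qed simp

lemma coset_word_head:
  assumes "reduced_word h" "coset_word Z h w = b # q"
  shows "\<exists>u a v. w = u @ a # v \<and> fst ` set u \<subseteq> Z \<and> fst a \<notin> Z \<and> b = ((reduce_word (h @ u), fst a), snd a)"
  using assms
proof (induction w arbitrary: h)
  case (Cons a w)
  show ?case
  proof (cases "fst a \<in> Z")
    case True
    then have "coset_word Z (reduce_word (h @ [a])) w = b # q" using Cons.prems by simp
    then obtain u a' v where w: "w = u @ a' # v" "fst ` set u \<subseteq> Z" "fst a' \<notin> Z"
        "b = ((reduce_word (reduce_word (h @ [a]) @ u), fst a'), snd a')"
      using Cons.IH[OF reduced_reduce] by blast
    then show ?thesis
      using True by (intro exI[of _ "a # u"] exI[of _ a'] exI[of _ v]) (simp add: reduce_append_left)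
  next
    case False
    then show ?thesis
      using Cons.prems by (intro exI[of _ "[]"] exI[of _ a] exI[of _ w]) (auto simp: reduce_reduced)
  qed
qed simp

lemma reduced_append_left: "reduced_word (u @ v) \<Longrightarrow> reduced_word u"
  by (simp add: reduced_word_def successively_append_iff)

text \<open>
  Two consecutive emitted symbols can only cancel if the word \<open>u\<close> in \<open>Z\<close> between the two
  letters satisfies \<open>h u = h\<close>. As \<open>u\<close> is reduced this means that \<open>u\<close> is empty, and then the
  original word was not reduced.
\<close>

lemma reduced_coset_word:
  assumes "reduced_word w" "reduced_word h"
  shows "reduced_word (coset_word Z h w)"
  using assms
proof (induction w arbitrary: h)
  case (Cons a w)
  have w: "reduced_word w" using Cons.prems by (simp add: reduced_Cons)
  show ?case
  proof (cases "fst a \<in> Z")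
    case True
    then show ?thesis using Cons.IH[OF w reduced_reduce] by simp
  next
    case False
    have "b \<noteq> inv_letter ((h, fst a), snd a)" if bq: "coset_word Z h w = b # q" for b q
    proof
      assume b: "b = inv_letter ((h, fst a), snd a)"
      obtain u a' v where uv: "w = u @ a' # v" "b = ((reduce_word (h @ u), fst a'), snd a')"
        using coset_word_head[OF Cons.prems(2) bq] by blast
      have hu: "reduce_word (h @ u) = h" and a': "a' = inv_letter a"
        using b uv(2) by (auto simp: inv_letter_def prod_eq_iff)
      interpret F: group "free_group (UNIV :: 'a set)" by (rule group_free_group)
      have "u \<in> carrier (free_group UNIV)" "h \<in> carrier (free_group UNIV)"
        using reduced_append_left[of u] w Cons.prems by (auto simp: carrier_free_group uv(1))
      then have "u = []"
        using F.l_cancel_one[of h u] hu by (simp add: mult_free_group one_free_group)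
      then show False using Cons.prems(1) by (simp add: uv(1) a' reduced_Cons)
    qed
    then show ?thesis
      using False Cons.IH[OF w Cons.prems(2)] by (cases "coset_word Z h w") (auto simp: reduced_Cons)
  qed
qed simp

definition relabel :: "('a \<Rightarrow> 'b) \<Rightarrow> ('a \<times> 'c) free_word \<Rightarrow> ('b \<times> 'c) free_word" where
  "relabel c w = map (apfst (apfst c)) w"

lemma reduced_relabel:
  assumes "reduced_word w" "inj_on c (fst ` fst ` set w)"
  shows "reduced_word (relabel c w)"
  using assms
proof (induction w)
  case (Cons a w)
  have "reduced_word (relabel c w)"
    using Cons by (auto simp: reduced_Cons intro: inj_on_subset)
  moreover have "b = inv_letter a"
    if "b \<in> set w" "apfst (apfst c) b = inv_letter (apfst (apfst c) a)" for b
    using that Cons.prems(2) by (auto simp: inv_letter_def prod_eq_iff inj_on_def)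
  ultimately show ?case
    using Cons.prems(1) by (cases w) (auto simp: relabel_def reduced_Cons)
qed (simp add: relabel_def)

text \<open>
  The value of the rewritten word in the free group on pairs \<open>(class, y)\<close>, after each \<open>h\<close> has been replaced
  by its class \<open>c h\<close>. On the kernel (with \<open>h = 1\<close>) this is the homomorphism of free groups
  that \<open>c\<close> induces; on the whole group it is a crossed homomorphism, see \<open>coset_eval_append\<close>.
\<close>

definition coset_eval :: "('a free_word \<Rightarrow> 'b) \<Rightarrow> 'a set \<Rightarrow> 'a free_word \<Rightarrow> 'a free_word \<Rightarrow> ('b \<times> 'a) free_word" where
  "coset_eval c Z h w = reduce_word (relabel c (coset_word Z h w))"

lemma coset_eval_Nil [simp]: "coset_eval c Z h [] = []"
  by (simp add: coset_eval_def relabel_def reduce_word_def)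

lemma coset_eval_Cons:
  "coset_eval c Z h (a # w) =
    (if fst a \<in> Z then coset_eval c Z (reduce_word (h @ [a])) w
     else cons_letter ((c h, fst a), snd a) (coset_eval c Z h w))"
  by (simp add: coset_eval_def relabel_def reduce_Cons)

lemma reduce_cancel_right:
  assumes "reduced_word h"
  shows "reduce_word (reduce_word (h @ [a]) @ [inv_letter a]) = h"
proof -
  have "reduce_word (reduce_word (h @ [a]) @ [inv_letter a]) = reduce_word (h @ reduce_word [a, inv_letter a])"
    by (simp add: reduce_append_left reduce_append_right)
  then show ?thesis using assms by (simp add: reduce_word_def reduce_reduced[unfolded reduce_word_def])
qed

lemma coset_eval_cons_letter:
  assumes h: "reduced_word h"
  shows "coset_eval c Z h (cons_letter a w) = coset_eval c Z h (a # w)"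
proof (cases "w = [] \<or> hd w \<noteq> inv_letter a")
  case True
  then show ?thesis by (cases w) auto
next
  case False
  then obtain v where w: "w = inv_letter a # v" by (cases w) auto
  show ?thesis
  proof (cases "fst a \<in> Z")
    case True
    then show ?thesis
      by (simp add: w coset_eval_Cons reduce_cancel_right[OF h])
  next
    case False
    have "reduced_word (coset_eval c Z h v)" by (simp add: coset_eval_def reduced_reduce)
    from cons_letter_cancel[OF this, of "((c h, fst a), snd a)"] False show ?thesis
      by (simp add: w coset_eval_Cons inv_letter_def)
  qed
qed

lemma coset_eval_reduce_word:
  "reduced_word h \<Longrightarrow> coset_eval c Z h (reduce_word w) = coset_eval c Z h w"
proof (induction w arbitrary: h)
  case (Cons a w)
  then show ?case
    by (simp add: reduce_Cons coset_eval_cons_letter) (simp add: coset_eval_Cons reduced_reduce)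
qed (simp add: reduce_word_def)

lemma coset_eval_append:
  assumes "reduced_word h"
  shows "coset_eval c Z h (u @ v) =
    reduce_word (coset_eval c Z h u @ coset_eval c Z (reduce_word (h @ retract_word Z u)) v)"
  by (simp add: coset_eval_def coset_word_append[OF assms] relabel_def reduce_append_left reduce_append_right)

text \<open>
  The rewritten word is reduced, and stays so under an injective renaming of its symbols.
  It is nonempty because a word without letters outside \<open>Z\<close> is its own retract.
\<close>

lemma coset_eval_nontrivial:
  assumes w: "w \<in> carrier (free_group X)" and "retract_word Z w = []" and "w \<noteq> []"
    and inj: "inj_on c (fst ` fst ` set (coset_word Z [] w))"
  shows "coset_eval c Z [] w \<noteq> []"
proof -
  have red: "reduced_word w" using w by (simp add: carrier_free_group)
  have "coset_word Z [] w \<noteq> []"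
  proof
    assume "coset_word Z [] w = []"
    then have "w \<in> carrier (free_group Z)"
      using red coset_word_eq_Nil[of Z "[]" w] by (simp add: carrier_free_group)
    then show False using retract_of_subgroup[of w Z] assms(2,3) by simp
  qed
  moreover have "reduced_word (relabel c (coset_word Z [] w))"
    by (rule reduced_relabel[OF reduced_coset_word[OF red] inj]) simp
  ultimately show ?thesis
    by (simp add: coset_eval_def reduce_reduced relabel_def)
qed

section \<open>A length on a semidirect product\<close>

text \<open>
  Here \<open>p (r p)\<^sup>-\<^sup>1\<close> is the kernel component of \<open>p\<close> when \<open>r\<close> is a retraction. The kernel
  component of \<open>pq\<close> is that of \<open>p\<close> times a conjugate of that of \<open>q\<close>, which is why
  \<open>k\<close> has to be invariant under conjugation.
\<close>

lemma (in group) twisted_length: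
  assumes n: "group_length G n" and k: "group_length G k" and r: "r \<in> hom G G"
    and k_conj: "\<And>u x. u \<in> carrier G \<Longrightarrow> x \<in> carrier G \<Longrightarrow> k (u \<otimes> x \<otimes> inv u) = k x"
  shows "group_length G (\<lambda>p. n p + k (p \<otimes> inv (r p)))"
proof -
  interpret n: group_length G n by (rule n)
  interpret k: group_length G k by (rule k)
  interpret r: group_hom G G r by unfold_locales (rule r)
  show ?thesis
  proof
    show "n \<one> + k (\<one> \<otimes> inv (r \<one>)) = 0"
      by (simp add: n.length_one k.length_one)
    show "0 \<le> n p + k (p \<otimes> inv (r p))" if "p \<in> carrier G" for p
      using n.length_nonneg[OF that] k.length_nonneg[of "p \<otimes> inv (r p)"] that by simp
    show "n (inv p) + k (inv p \<otimes> inv (r (inv p))) = n p + k (p \<otimes> inv (r p))"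
      if p: "p \<in> carrier G" for p
    proof -
      have "inv p \<otimes> inv (r (inv p)) = inv p \<otimes> inv (p \<otimes> inv (r p)) \<otimes> inv (inv p)"
        using p by (simp add: inv_mult_group m_assoc)
      then have "k (inv p \<otimes> inv (r (inv p))) = k (inv (p \<otimes> inv (r p)))"
        using k_conj[of "inv p" "inv (p \<otimes> inv (r p))"] p by simp
      also have "\<dots> = k (p \<otimes> inv (r p))" using p by (intro k.length_inv) simp
      finally show ?thesis using p by (simp add: n.length_inv)
    qed
    show "n (p \<otimes> q) + k (p \<otimes> q \<otimes> inv (r (p \<otimes> q)))
        \<le> n p + k (p \<otimes> inv (r p)) + (n q + k (q \<otimes> inv (r q)))"
      if p: "p \<in> carrier G" and q: "q \<in> carrier G" for p q
    proof -
      have "p \<otimes> q \<otimes> inv (r (p \<otimes> q)) = (p \<otimes> inv (r p)) \<otimes> (r p \<otimes> (q \<otimes> inv (r q)) \<otimes> inv (r p))"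
        using p q by (simp add: inv_mult_group m_assoc mult_inv_cancel_left)
      then have "k (p \<otimes> q \<otimes> inv (r (p \<otimes> q)))
          \<le> k (p \<otimes> inv (r p)) + k (r p \<otimes> (q \<otimes> inv (r q)) \<otimes> inv (r p))"
        using k.length_mult[of "p \<otimes> inv (r p)" "r p \<otimes> (q \<otimes> inv (r q)) \<otimes> inv (r p)"] p q by simp
      also have "k (r p \<otimes> (q \<otimes> inv (r q)) \<otimes> inv (r p)) = k (q \<otimes> inv (r q))"
        using p q by (intro k_conj) auto
      finally show ?thesis using n.length_mult[OF p q] by linarith
    qed
  qed
qed

text \<open>
  With \<open>m = p\<^sup>-\<^sup>1 r(p)\<close>, the kernel component of \<open>p q p\<^sup>-\<^sup>1\<close> is conjugate to the kernel component of
  \<open>q\<close> times the commutator of \<open>r(q)\<close> and \<open>m\<close>. The hypothesis on commutators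
  says that the image of \<open>r\<close> acts continuously on the kernel.
\<close>

lemma (in group) twisted_length_conj:
  assumes n: "group_length G n" and k: "group_length G k" and r: "r \<in> hom G G"
    and k_conj: "\<And>u x. u \<in> carrier G \<Longrightarrow> x \<in> carrier G \<Longrightarrow> k (u \<otimes> x \<otimes> inv u) = k x"
    and n_cont: "\<And>e. e > 0 \<Longrightarrow> \<exists>d>0. \<forall>q\<in>carrier G. n q < d \<longrightarrow> n (p \<otimes> q \<otimes> inv p) < e"
    and commutator: "\<And>e. e > 0 \<Longrightarrow> \<exists>d>0. \<forall>q\<in>carrier G. n q < d \<longrightarrow>
      k (r q \<otimes> (inv p \<otimes> r p) \<otimes> inv (r q) \<otimes> inv (inv p \<otimes> r p)) < e"
    and p: "p \<in> carrier G" and e: "e > 0"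
  shows "\<exists>d>0. \<forall>q\<in>carrier G. n q + k (q \<otimes> inv (r q)) < d \<longrightarrow>
    n (p \<otimes> q \<otimes> inv p) + k (p \<otimes> q \<otimes> inv p \<otimes> inv (r (p \<otimes> q \<otimes> inv p))) < e"
proof -
  interpret n: group_length G n by (rule n)
  interpret k: group_length G k by (rule k)
  interpret r: group_hom G G r by unfold_locales (rule r)
  obtain d1 where d1: "d1 > 0" "\<And>q. q \<in> carrier G \<Longrightarrow> n q < d1 \<Longrightarrow> n (p \<otimes> q \<otimes> inv p) < e/3"
    using n_cont[of "e/3"] e by auto
  obtain d2 where d2: "d2 > 0" "\<And>q. q \<in> carrier G \<Longrightarrow> n q < d2 \<Longrightarrow>
      k (r q \<otimes> (inv p \<otimes> r p) \<otimes> inv (r q) \<otimes> inv (inv p \<otimes> r p)) < e/3"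
    using commutator[of "e/3"] e by auto
  show ?thesis
  proof (intro exI[of _ "min (e/3) (min d1 d2)"] conjI ballI impI)
    fix q assume q: "q \<in> carrier G" and less: "n q + k (q \<otimes> inv (r q)) < min (e/3) (min d1 d2)"
    have "0 \<le> n q" "0 \<le> k (q \<otimes> inv (r q))"
      using n.length_nonneg[OF q] k.length_nonneg[of "q \<otimes> inv (r q)"] q by auto
    then have n_small: "n q < d1" "n q < d2" and k_small: "k (q \<otimes> inv (r q)) < e/3"
      using less by auto
    let ?c = "r q \<otimes> (inv p \<otimes> r p) \<otimes> inv (r q) \<otimes> inv (inv p \<otimes> r p)"
    have "p \<otimes> q \<otimes> inv p \<otimes> inv (r (p \<otimes> q \<otimes> inv p)) = p \<otimes> ((q \<otimes> inv (r q)) \<otimes> ?c) \<otimes> inv p"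
      using p q by (simp add: inv_mult_group m_assoc mult_inv_cancel_left)
    then have "k (p \<otimes> q \<otimes> inv p \<otimes> inv (r (p \<otimes> q \<otimes> inv p))) = k ((q \<otimes> inv (r q)) \<otimes> ?c)"
      using p q k_conj[of p "(q \<otimes> inv (r q)) \<otimes> ?c"] by simp
    also have "\<dots> \<le> k (q \<otimes> inv (r q)) + k ?c"
      using p q by (intro k.length_mult) auto
    finally show "n (p \<otimes> q \<otimes> inv p) + k (p \<otimes> q \<otimes> inv p \<otimes> inv (r (p \<otimes> q \<otimes> inv p))) < e"
      using k_small d1(2)[OF q n_small(1)] d2(2)[OF q n_small(2)] by linarith
  qed (use d1 d2 e in auto)
qed


section \<open>Extending a length from a free factor\<close>

text \<open>
  The quotient of the basis elements \<open>h y h\<^sup>-\<^sup>1\<close> and \<open>h' y h'\<^sup>-\<^sup>1\<close> with \<open>h' = h g\<close> is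
  \<open>h (y g y\<^sup>-\<^sup>1 g\<^sup>-\<^sup>1) h\<^sup>-\<^sup>1\<close>, and it receives the distance \<open>N(g)\<close> of \<open>h\<close> and \<open>h'\<close>. Admitting all
  conjugators \<open>u\<close> makes the resulting length conjugation-invariant: it is the Graev length.
\<close>

definition commutator_weights :: "'a set \<Rightarrow> 'a set \<Rightarrow> ('a free_word \<Rightarrow> real) \<Rightarrow> ('a free_word \<times> real) set" where
  "commutator_weights X Z N = {(u \<otimes>\<^bsub>free_group X\<^esub> (free_gen y \<otimes>\<^bsub>free_group X\<^esub> g \<otimes>\<^bsub>free_group X\<^esub>
      inv\<^bsub>free_group X\<^esub> free_gen y \<otimes>\<^bsub>free_group X\<^esub> inv\<^bsub>free_group X\<^esub> g) \<otimes>\<^bsub>free_group X\<^esub> inv\<^bsub>free_group X\<^esub> u, N g) |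
      u y g. u \<in> carrier (free_group X) \<and> y \<in> X - Z \<and> g \<in> carrier (free_group Z)}"

locale normed_free_factor =
  fixes X Z :: "'a set" and N :: "'a free_word \<Rightarrow> real"
  assumes Z_subset: "Z \<subseteq> X"
    and N_length: "group_length (free_group Z) N"
    and N_definite: "\<And>x. x \<in> carrier (free_group Z) \<Longrightarrow> N x = 0 \<Longrightarrow> x = []"
    and N_conj: "\<And>p e. p \<in> carrier (free_group Z) \<Longrightarrow> e > 0 \<Longrightarrow>
      \<exists>d>0. \<forall>q\<in>carrier (free_group Z). N q < d \<longrightarrow>
        N (p \<otimes>\<^bsub>free_group Z\<^esub> q \<otimes>\<^bsub>free_group Z\<^esub> inv\<^bsub>free_group Z\<^esub> p) < e"
begin

abbreviation P where "P \<equiv> free_group X"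
abbreviation R where "R \<equiv> retract_word Z"
abbreviation k where "k \<equiv> weighted_length P (commutator_weights X Z N)"
abbreviation L where "L \<equiv> \<lambda>p. N (R p) + k (p \<otimes>\<^bsub>P\<^esub> inv\<^bsub>P\<^esub> (R p))"

sublocale P: group P by (rule group_free_group)
sublocale F: group_length "free_group Z" N by (rule N_length)

lemma subgroup_carrier: "g \<in> carrier (free_group Z) \<Longrightarrow> g \<in> carrier P"
  using Z_subset by (auto simp: carrier_free_group)

lemma mult_subgroup: "x \<otimes>\<^bsub>free_group Z\<^esub> y = x \<otimes>\<^bsub>P\<^esub> y"
  by (simp add: mult_free_group)

lemma inv_subgroup: "g \<in> carrier (free_group Z) \<Longrightarrow> inv\<^bsub>free_group Z\<^esub> g = inv\<^bsub>P\<^esub> g"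
  using P.inv_equality[of "inv\<^bsub>free_group Z\<^esub> g" g] F.l_inv[of g] F.inv_closed[of g]
  by (simp add: mult_subgroup one_free_group subgroup_carrier)

lemma R_hom: "R \<in> hom P P"
  by (auto simp: hom_def mult_free_group retract_reduce_word retract_append
      intro: subgroup_carrier retract_in_carrier)

sublocale R: group_hom P P R by unfold_locales (rule R_hom)

lemma N_inv: "g \<in> carrier (free_group Z) \<Longrightarrow> N (inv\<^bsub>P\<^esub> g) = N g"
  using F.length_inv[of g] by (simp add: inv_subgroup)

lemma inv_in_subgroup: "g \<in> carrier (free_group Z) \<Longrightarrow> inv\<^bsub>P\<^esub> g \<in> carrier (free_group Z)"
  using F.inv_closed[of g] by (simp add: inv_subgroup)

lemma retract_length: "group_length P (\<lambda>p. N (R p))"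
proof
  show "N (R \<one>\<^bsub>P\<^esub>) = 0" using F.length_one by (simp add: one_free_group)
  show "N (R (x \<otimes>\<^bsub>P\<^esub> y)) \<le> N (R x) + N (R y)" if "x \<in> carrier P" "y \<in> carrier P" for x y
    using that F.length_mult[OF retract_in_carrier retract_in_carrier, of x y]
    by (simp add: mult_subgroup)
  show "N (R (inv\<^bsub>P\<^esub> x)) = N (R x)" if "x \<in> carrier P" for x
    using that by (simp add: N_inv retract_in_carrier)
qed (simp add: F.length_nonneg retract_in_carrier)

lemma free_gen_carrier: "y \<in> X - Z \<Longrightarrow> free_gen y \<in> carrier P"
  by (simp add: free_gen_in_carrier)

abbreviation comm where
  "comm y g \<equiv> free_gen y \<otimes>\<^bsub>P\<^esub> g \<otimes>\<^bsub>P\<^esub> inv\<^bsub>P\<^esub> free_gen y \<otimes>\<^bsub>P\<^esub> inv\<^bsub>P\<^esub> g"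

lemma commutator_weightsE:
  assumes "(a, r) \<in> commutator_weights X Z N"
  obtains u y g where "u \<in> carrier P" "y \<in> X - Z" "g \<in> carrier (free_group Z)"
    "a = u \<otimes>\<^bsub>P\<^esub> comm y g \<otimes>\<^bsub>P\<^esub> inv\<^bsub>P\<^esub> u" "r = N g"
  using assms unfolding commutator_weights_def by blast

lemma commutator_weightsI:
  assumes "u \<in> carrier P" "y \<in> X - Z" "g \<in> carrier (free_group Z)"
  shows "(u \<otimes>\<^bsub>P\<^esub> comm y g \<otimes>\<^bsub>P\<^esub> inv\<^bsub>P\<^esub> u, N g) \<in> commutator_weights X Z N"
  using assms unfolding commutator_weights_def by blast

lemma commutator_weights_conj:
  assumes v: "v \<in> carrier P" and "(a, r) \<in> commutator_weights X Z N"
  shows "(v \<otimes>\<^bsub>P\<^esub> a \<otimes>\<^bsub>P\<^esub> inv\<^bsub>P\<^esub> v, r) \<in> commutator_weights X Z N"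
proof -
  obtain u y g where *: "u \<in> carrier P" "y \<in> X - Z" "g \<in> carrier (free_group Z)"
      "a = u \<otimes>\<^bsub>P\<^esub> comm y g \<otimes>\<^bsub>P\<^esub> inv\<^bsub>P\<^esub> u" "r = N g"
    using assms(2) by (rule commutator_weightsE)
  have "v \<otimes>\<^bsub>P\<^esub> a \<otimes>\<^bsub>P\<^esub> inv\<^bsub>P\<^esub> v = (v \<otimes>\<^bsub>P\<^esub> u) \<otimes>\<^bsub>P\<^esub> comm y g \<otimes>\<^bsub>P\<^esub> inv\<^bsub>P\<^esub> (v \<otimes>\<^bsub>P\<^esub> u)"
    using * v by (simp add: P.m_assoc P.inv_mult_group subgroup_carrier free_gen_carrier)
  then show ?thesis using commutator_weightsI[of "v \<otimes>\<^bsub>P\<^esub> u" y g] * v by simp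
qed

sublocale K: weighted_group P "commutator_weights X Z N"
proof
  fix a r assume "(a, r) \<in> commutator_weights X Z N"
  then obtain u y g where *: "u \<in> carrier P" "y \<in> X - Z" "g \<in> carrier (free_group Z)"
      "a = u \<otimes>\<^bsub>P\<^esub> comm y g \<otimes>\<^bsub>P\<^esub> inv\<^bsub>P\<^esub> u" "r = N g"
    by (rule commutator_weightsE)
  show "a \<in> carrier P"
    using * by (simp add: subgroup_carrier free_gen_carrier)
  show "0 \<le> r" using * F.length_nonneg by simp
  have "inv\<^bsub>P\<^esub> a = (u \<otimes>\<^bsub>P\<^esub> g) \<otimes>\<^bsub>P\<^esub> comm y (inv\<^bsub>P\<^esub> g) \<otimes>\<^bsub>P\<^esub> inv\<^bsub>P\<^esub> (u \<otimes>\<^bsub>P\<^esub> g)"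
    using * by (simp add: P.m_assoc P.inv_mult_group subgroup_carrier free_gen_carrier P.mult_inv_cancel_left)
  then show "(inv\<^bsub>P\<^esub> a, r) \<in> commutator_weights X Z N"
    using commutator_weightsI[of "u \<otimes>\<^bsub>P\<^esub> g" y "inv\<^bsub>P\<^esub> g"] *
    by (simp add: subgroup_carrier inv_in_subgroup N_inv)
qed

lemma k_conj: "u \<in> carrier P \<Longrightarrow> x \<in> carrier P \<Longrightarrow> k (u \<otimes>\<^bsub>P\<^esub> x \<otimes>\<^bsub>P\<^esub> inv\<^bsub>P\<^esub> u) = k x"
  by (rule K.weighted_length_conj[OF commutator_weights_conj])

lemma k_comm: "y \<in> X - Z \<Longrightarrow> g \<in> carrier (free_group Z) \<Longrightarrow> k (comm y g) \<le> N g"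
  using K.weighted_length_le_weight[OF commutator_weightsI[OF P.one_closed, of y g]]
  by (simp add: free_gen_carrier subgroup_carrier)

text \<open>
  Acting by \<open>g\<close> moves a basis element of the kernel by at most the weight of a conjugate of \<open>g\<close>;
  this is the case \<open>h = 1\<close>, for a generator and for its inverse.
\<close>

lemma k_letter_commutator:
  assumes a: "fst a \<in> X - Z" and g: "g \<in> carrier (free_group Z)"
  shows "k (g \<otimes>\<^bsub>P\<^esub> [a] \<otimes>\<^bsub>P\<^esub> inv\<^bsub>P\<^esub> g \<otimes>\<^bsub>P\<^esub> inv\<^bsub>P\<^esub> [a]) \<le> N g"
proof -
  let ?y = "free_gen (fst a)"
  have carrier: "?y \<in> carrier P" "g \<in> carrier P"
    using a g by (auto simp: free_gen_carrier subgroup_carrier)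
  show ?thesis
  proof (cases "snd a")
    case True
    then have "[a] = ?y" by (simp add: free_gen_def prod_eq_iff)
    moreover have "g \<otimes>\<^bsub>P\<^esub> ?y \<otimes>\<^bsub>P\<^esub> inv\<^bsub>P\<^esub> g \<otimes>\<^bsub>P\<^esub> inv\<^bsub>P\<^esub> ?y = inv\<^bsub>P\<^esub> (comm (fst a) g)"
      using carrier by (simp add: P.m_assoc P.inv_mult_group)
    ultimately show ?thesis
      using K.length_inv[of "comm (fst a) g"] k_comm[OF a g] carrier by simp
  next
    case False
    then have "a = (fst a, False)" by (simp add: prod_eq_iff)
    then have "[a] = inv\<^bsub>P\<^esub> ?y" using inv_free_gen[of "fst a" X] a by auto
    moreover have "g \<otimes>\<^bsub>P\<^esub> inv\<^bsub>P\<^esub> ?y \<otimes>\<^bsub>P\<^esub> inv\<^bsub>P\<^esub> g \<otimes>\<^bsub>P\<^esub> inv\<^bsub>P\<^esub> (inv\<^bsub>P\<^esub> ?y) =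
        inv\<^bsub>P\<^esub> ?y \<otimes>\<^bsub>P\<^esub> comm (fst a) g \<otimes>\<^bsub>P\<^esub> inv\<^bsub>P\<^esub> (inv\<^bsub>P\<^esub> ?y)"
      using carrier by (simp add: P.m_assoc P.mult_inv_cancel_left)
    ultimately show ?thesis
      using k_conj[of "inv\<^bsub>P\<^esub> ?y" "comm (fst a) g"] k_comm[OF a g] carrier by simp
  qed
qed

lemma R_subgroup: "g \<in> carrier (free_group Z) \<Longrightarrow> R g = g"
  by (rule retract_of_subgroup)

lemma N_conj':
  assumes "p \<in> carrier (free_group Z)" "e > 0"
  shows "\<exists>d>0. \<forall>q\<in>carrier (free_group Z). N q < d \<longrightarrow> N (p \<otimes>\<^bsub>P\<^esub> q \<otimes>\<^bsub>P\<^esub> inv\<^bsub>P\<^esub> p) < e"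
  using N_conj[OF assms] inv_subgroup[OF assms(1)] by (simp add: mult_subgroup)

text \<open>
  The action of \<open>F(Z)\<close> on the kernel is continuous. It suffices to move one basis element at a time, since
  the commutator of \<open>g\<close> and \<open>m n\<close> is the commutator of \<open>g\<close> and \<open>m\<close> times a conjugate of that of
  \<open>g\<close> and \<open>n\<close>. Prefixing \<open>w\<close> with a letter in \<open>Z\<close> does not change \<open>w\<^sup>-\<^sup>1 r(w)\<close>; a letter \<open>a\<close>
  outside \<open>Z\<close> contributes \<open>n = h\<^sup>-\<^sup>1 a\<^sup>-\<^sup>1 h\<close> with \<open>h = r(w)\<close>, and the length of \<open>h g h\<^sup>-\<^sup>1\<close> tends to
  zero with that of \<open>g\<close>.
\<close>

lemma k_commutator_small:
  assumes "w \<in> carrier P" "e > 0"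
  shows "\<exists>d>0. \<forall>g\<in>carrier (free_group Z). N g < d \<longrightarrow>
    k (g \<otimes>\<^bsub>P\<^esub> (inv\<^bsub>P\<^esub> w \<otimes>\<^bsub>P\<^esub> R w) \<otimes>\<^bsub>P\<^esub> inv\<^bsub>P\<^esub> g \<otimes>\<^bsub>P\<^esub> inv\<^bsub>P\<^esub> (inv\<^bsub>P\<^esub> w \<otimes>\<^bsub>P\<^esub> R w)) < e"
  using assms
proof (induction w arbitrary: e)
  case Nil
  have "inv\<^bsub>P\<^esub> [] \<otimes>\<^bsub>P\<^esub> R [] = \<one>\<^bsub>P\<^esub>"
    by (simp add: one_free_group[of X, symmetric])
  then have "k (g \<otimes>\<^bsub>P\<^esub> (inv\<^bsub>P\<^esub> [] \<otimes>\<^bsub>P\<^esub> R []) \<otimes>\<^bsub>P\<^esub> inv\<^bsub>P\<^esub> g \<otimes>\<^bsub>P\<^esub> inv\<^bsub>P\<^esub> (inv\<^bsub>P\<^esub> [] \<otimes>\<^bsub>P\<^esub> R [])) = 0"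
    if "g \<in> carrier (free_group Z)" for g
    using that by (simp add: subgroup_carrier K.length_one del: retract_word_Nil)
  then show ?case using Nil.prems by (intro exI[of _ 1]) simp
next
  case (Cons a w)
  let ?m = "inv\<^bsub>P\<^esub> w \<otimes>\<^bsub>P\<^esub> R w"
  have red: "reduced_word (a # w)" and aX: "fst a \<in> X" and w: "w \<in> carrier P"
    using Cons.prems by (auto simp: carrier_free_group reduced_Cons)
  have a: "[a] \<in> carrier P" using aX by (rule singleton_in_carrier)
  have aw: "a # w = [a] \<otimes>\<^bsub>P\<^esub> w" by (rule Cons_free_group[OF red])
  show ?case
  proof (cases "fst a \<in> Z")
    case True
    then have "R [a] = [a]" by (intro R_subgroup singleton_in_carrier)
    then have "inv\<^bsub>P\<^esub> (a # w) \<otimes>\<^bsub>P\<^esub> R (a # w) = ?m"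
      using a w by (simp add: aw P.inv_mult_group P.m_assoc P.mult_inv_cancel_left)
    then show ?thesis using Cons.IH[OF w Cons.prems(2)] by simp
  next
    case False
    let ?h = "R w" and ?b = "inv\<^bsub>P\<^esub> [a]"
    have b: "?b = [inv_letter a]"
      by (rule P.inv_equality)
        (use aX in \<open>auto simp: mult_free_group one_free_group reduce_word_def intro!: singleton_in_carrier\<close>)
    have h: "?h \<in> carrier P" "?h \<in> carrier (free_group Z)" using w by (auto intro: retract_in_carrier)
    have Ra: "R [a] = \<one>\<^bsub>P\<^esub>" using False by (simp add: retract_word_def reduce_word_def one_free_group)
    let ?n = "inv\<^bsub>P\<^esub> ?h \<otimes>\<^bsub>P\<^esub> ?b \<otimes>\<^bsub>P\<^esub> ?h"
    have m: "inv\<^bsub>P\<^esub> (a # w) \<otimes>\<^bsub>P\<^esub> R (a # w) = ?m \<otimes>\<^bsub>P\<^esub> ?n"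
      using a w h Ra by (simp add: aw P.inv_mult_group P.m_assoc P.mult_inv_cancel_left)
    obtain d1 where d1: "d1 > 0" "\<And>g. g \<in> carrier (free_group Z) \<Longrightarrow> N g < d1 \<Longrightarrow>
        k (g \<otimes>\<^bsub>P\<^esub> ?m \<otimes>\<^bsub>P\<^esub> inv\<^bsub>P\<^esub> g \<otimes>\<^bsub>P\<^esub> inv\<^bsub>P\<^esub> ?m) < e/2"
      using Cons.IH[OF w, of "e/2"] Cons.prems(2) by auto
    obtain d2 where d2: "d2 > 0" "\<And>g. g \<in> carrier (free_group Z) \<Longrightarrow> N g < d2 \<Longrightarrow>
        N (?h \<otimes>\<^bsub>P\<^esub> g \<otimes>\<^bsub>P\<^esub> inv\<^bsub>P\<^esub> ?h) < e/2"
      using N_conj'[OF h(2), of "e/2"] Cons.prems(2) by auto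
    show ?thesis
    proof (intro exI[of _ "min d1 d2"] conjI ballI impI)
      fix g assume gZ: "g \<in> carrier (free_group Z)" and less: "N g < min d1 d2"
      have g: "g \<in> carrier P" using gZ by (rule subgroup_carrier)
      let ?g = "?h \<otimes>\<^bsub>P\<^esub> g \<otimes>\<^bsub>P\<^esub> inv\<^bsub>P\<^esub> ?h"
      have g': "?g \<in> carrier (free_group Z)"
        using F.m_closed[OF F.m_closed[OF h(2) gZ] F.inv_closed[OF h(2)]] h(2)
        by (simp add: mult_subgroup inv_subgroup)
      let ?A = "g \<otimes>\<^bsub>P\<^esub> ?m \<otimes>\<^bsub>P\<^esub> inv\<^bsub>P\<^esub> g \<otimes>\<^bsub>P\<^esub> inv\<^bsub>P\<^esub> ?m"
      let ?B = "?g \<otimes>\<^bsub>P\<^esub> ?b \<otimes>\<^bsub>P\<^esub> inv\<^bsub>P\<^esub> ?g \<otimes>\<^bsub>P\<^esub> inv\<^bsub>P\<^esub> ?b"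
      let ?v = "?m \<otimes>\<^bsub>P\<^esub> inv\<^bsub>P\<^esub> ?h"
      have closed: "?A \<in> carrier P" "?B \<in> carrier P" "?v \<in> carrier P"
        using g h w a by simp_all
      have "g \<otimes>\<^bsub>P\<^esub> (?m \<otimes>\<^bsub>P\<^esub> ?n) \<otimes>\<^bsub>P\<^esub> inv\<^bsub>P\<^esub> g \<otimes>\<^bsub>P\<^esub> inv\<^bsub>P\<^esub> (?m \<otimes>\<^bsub>P\<^esub> ?n)
          = ?A \<otimes>\<^bsub>P\<^esub> (?v \<otimes>\<^bsub>P\<^esub> ?B \<otimes>\<^bsub>P\<^esub> inv\<^bsub>P\<^esub> ?v)"
        using g h w a by (simp add: P.m_assoc P.inv_mult_group P.mult_inv_cancel_left)
      then have "k (g \<otimes>\<^bsub>P\<^esub> (?m \<otimes>\<^bsub>P\<^esub> ?n) \<otimes>\<^bsub>P\<^esub> inv\<^bsub>P\<^esub> g \<otimes>\<^bsub>P\<^esub> inv\<^bsub>P\<^esub> (?m \<otimes>\<^bsub>P\<^esub> ?n))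
          \<le> k ?A + k (?v \<otimes>\<^bsub>P\<^esub> ?B \<otimes>\<^bsub>P\<^esub> inv\<^bsub>P\<^esub> ?v)"
        using K.length_mult[of ?A "?v \<otimes>\<^bsub>P\<^esub> ?B \<otimes>\<^bsub>P\<^esub> inv\<^bsub>P\<^esub> ?v"] closed by (metis P.m_closed P.inv_closed)
      also have "k (?v \<otimes>\<^bsub>P\<^esub> ?B \<otimes>\<^bsub>P\<^esub> inv\<^bsub>P\<^esub> ?v) = k ?B" by (rule k_conj[OF closed(3,2)])
      also have "k ?B \<le> N ?g"
        using k_letter_commutator[of "inv_letter a" ?g] g' aX False by (simp add: b)
      finally show "k (g \<otimes>\<^bsub>P\<^esub> (inv\<^bsub>P\<^esub> (a # w) \<otimes>\<^bsub>P\<^esub> R (a # w)) \<otimes>\<^bsub>P\<^esub> inv\<^bsub>P\<^esub> g \<otimes>\<^bsub>P\<^esub>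
          inv\<^bsub>P\<^esub> (inv\<^bsub>P\<^esub> (a # w) \<otimes>\<^bsub>P\<^esub> R (a # w))) < e"
        using d1(2)[OF gZ] d2(2)[OF gZ] less unfolding m by linarith
    qed (use d1 d2 in simp)
  qed
qed

lemma coset_eval_mult:
  "reduced_word h \<Longrightarrow> coset_eval c Z h (p \<otimes>\<^bsub>P\<^esub> q) =
    reduce_word (coset_eval c Z h p @ coset_eval c Z (reduce_word (h @ R p)) q)"
  by (simp add: mult_free_group coset_eval_reduce_word coset_eval_append)

lemma coset_eval_subgroup: "g \<in> carrier (free_group Z) \<Longrightarrow> coset_eval c Z h g = []"
  by (simp add: coset_eval_def coset_word_subgroup carrier_free_group relabel_def reduce_word_def)

lemma retract_comm:
  assumes "y \<in> X - Z" "g \<in> carrier (free_group Z)"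
  shows "R (comm y g) = []"
proof -
  have "R (free_gen y) = \<one>\<^bsub>P\<^esub>"
    using assms by (simp add: retract_word_def free_gen_def reduce_word_def one_free_group)
  then have "R (comm y g) = \<one>\<^bsub>P\<^esub>"
    using assms by (simp add: R_subgroup subgroup_carrier free_gen_carrier)
  then show ?thesis by (simp add: one_free_group)
qed

text \<open>
  Writing \<open>h\<close> for \<open>r(u)\<close>, the commutator of \<open>y\<close> and \<open>g\<close>, read from \<open>h\<close> on, emits \<open>(h, y)\<close> followed by
  the inverse of \<open>(h g, y)\<close>. These cancel once \<open>c\<close> identifies \<open>h\<close> and \<open>h g\<close>, and the
  contributions of \<open>u\<close> and \<open>u\<^sup>-\<^sup>1\<close> then cancel too, because the commutator has trivial retract.
\<close>

lemma coset_eval_conj_comm: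
  assumes u: "u \<in> carrier P" and y: "y \<in> X - Z" and g: "g \<in> carrier (free_group Z)"
    and c: "c (R u) = c (R u \<otimes>\<^bsub>P\<^esub> g)"
  shows "coset_eval c Z [] (u \<otimes>\<^bsub>P\<^esub> comm y g \<otimes>\<^bsub>P\<^esub> inv\<^bsub>P\<^esub> u) = []"
proof -
  let ?h = "R u" and ?e = "coset_eval c Z"
  have red: "reduced_word ?h" by (simp add: retract_word_def reduced_reduce)
  have red_eval: "reduced_word (?e h w)" for h w by (simp add: coset_eval_def reduced_reduce)
  have gP: "g \<in> carrier P" "inv\<^bsub>P\<^esub> g \<in> carrier (free_group Z)"
    using g by (auto simp: subgroup_carrier inv_in_subgroup)
  have inv_y: "inv\<^bsub>P\<^esub> free_gen y = [(y, False)]" using y by (simp add: inv_free_gen)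
  have Ry: "R (free_gen y) = []" "R [(y, False)] = []"
    using y by (simp_all add: retract_word_def free_gen_def reduce_word_def)
  have hg: "reduce_word (?h @ g) = ?h \<otimes>\<^bsub>P\<^esub> g" by (simp add: mult_free_group)
  have R1: "R (free_gen y \<otimes>\<^bsub>P\<^esub> g) = g"
    using y g gP Ry by (simp add: free_gen_carrier R_subgroup)
      (simp add: mult_free_group reduce_reduced carrier_free_group)
  have "R (free_gen y \<otimes>\<^bsub>P\<^esub> g \<otimes>\<^bsub>P\<^esub> inv\<^bsub>P\<^esub> free_gen y) = g \<otimes>\<^bsub>P\<^esub> R (inv\<^bsub>P\<^esub> free_gen y)"
    using R.hom_mult[of "free_gen y \<otimes>\<^bsub>P\<^esub> g" "inv\<^bsub>P\<^esub> free_gen y"] y gP R1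
    by (simp add: free_gen_carrier del: R.hom_mult R.hom_inv)
  also have "\<dots> = g"
    unfolding inv_y Ry using g by (simp add: mult_free_group reduce_reduced carrier_free_group)
  finally have R2: "R (free_gen y \<otimes>\<^bsub>P\<^esub> g \<otimes>\<^bsub>P\<^esub> inv\<^bsub>P\<^esub> free_gen y) = g" .
  have "?e ?h (comm y g) = reduce_word
      (?e ?h (free_gen y \<otimes>\<^bsub>P\<^esub> g \<otimes>\<^bsub>P\<^esub> inv\<^bsub>P\<^esub> free_gen y))"
    using gP by (simp add: coset_eval_mult[OF red, of c _ "inv\<^bsub>P\<^esub> g"] coset_eval_subgroup)
  also have "\<dots> = reduce_word (?e ?h (free_gen y \<otimes>\<^bsub>P\<^esub> g) @ ?e (?h \<otimes>\<^bsub>P\<^esub> g) [(y, False)])"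
    unfolding inv_y
    by (simp only: coset_eval_mult[OF red, of c _ "[(y, False)]"] R1 hg reduce_reduced[OF reduced_reduce])
  also have "?e ?h (free_gen y \<otimes>\<^bsub>P\<^esub> g) = ?e ?h (free_gen y)"
    using g by (simp add: coset_eval_mult[OF red] coset_eval_subgroup reduce_reduced red_eval)
  finally have comm: "?e ?h (comm y g) = []"
    using y c by (simp add: free_gen_def coset_eval_Cons reduce_word_def inv_letter_def)
  have Ruc: "R (u \<otimes>\<^bsub>P\<^esub> comm y g) = ?h"
    using u y g gP retract_comm[OF y g] R.hom_mult[of u "comm y g"]
    by (simp add: free_gen_carrier del: R.hom_mult R.hom_inv) (simp add: mult_free_group reduce_reduced red)
  have "?e [] (u \<otimes>\<^bsub>P\<^esub> comm y g \<otimes>\<^bsub>P\<^esub> inv\<^bsub>P\<^esub> u) = reduce_word (?e [] u @ ?e ?h (inv\<^bsub>P\<^esub> u))"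
    by (simp add: coset_eval_mult[of "[]" c "u \<otimes>\<^bsub>P\<^esub> comm y g"] Ruc reduce_reduced red)
      (simp add: coset_eval_mult reduce_reduced red comm red_eval)
  also have "\<dots> = ?e [] (u \<otimes>\<^bsub>P\<^esub> inv\<^bsub>P\<^esub> u)"
    by (simp add: coset_eval_mult reduce_reduced red)
  also have "\<dots> = []" using u by (simp add: one_free_group)
  finally show ?thesis .
qed

lemma F_pseudometric:
  "pseudometric_on (carrier (free_group Z)) (\<lambda>x y. N (inv\<^bsub>free_group Z\<^esub> x \<otimes>\<^bsub>free_group Z\<^esub> y))"
  unfolding pseudometric_on_def
  using F.length_diff_triangle F.length_diff_commute
  by (simp add: F.length_nonneg F.length_one)

text \<open>
  If \<open>p \<noteq> 1\<close>, a factorization of \<open>p\<close> that costs less than \<open>1\<close> and than all distances between the symbols of its rewritten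
  word yields a gluing \<open>c\<close> under which the factors evaluate to the identity while \<open>p\<close> does not.
\<close>

lemma k_definite:
  assumes p: "p \<in> carrier P" and Rp: "R p = []" and "k p = 0"
  shows "p = []"
proof (rule ccontr)
  assume "p \<noteq> []"
  let ?d = "\<lambda>x y. N (inv\<^bsub>free_group Z\<^esub> x \<otimes>\<^bsub>free_group Z\<^esub> y)"
  let ?A = "fst ` fst ` set (coset_word Z [] p)"
  have "[] \<in> carrier (free_group Z)" by (simp add: carrier_free_group)
  then have A: "?A \<subseteq> carrier (free_group Z)" by (rule coset_word_labels)
  have "finite ?A" by (intro finite_imageI finite_set)
  \<comment> \<open>The element \<open>1\<close> makes the minimum exist when only one \<open>h\<close> occurs, and bounds \<open>e\<close> by the cap of \<open>k\<close>.\<close>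
  let ?D = "insert 1 ((\<lambda>(x, y). ?d x y) ` {(x, y) \<in> ?A \<times> ?A. x \<noteq> y})"
  define e where "e = Min ?D"
  have "finite {(x, y) \<in> ?A \<times> ?A. x \<noteq> y}"
    by (rule finite_subset[OF _ finite_cartesian_product[OF \<open>finite ?A\<close> \<open>finite ?A\<close>]]) blast
  then have D: "finite ?D" by blast
  have "0 < ?d x y" if xy: "x \<in> ?A" "y \<in> ?A" "x \<noteq> y" for x y
  proof -
    have x: "x \<in> carrier (free_group Z)" "y \<in> carrier (free_group Z)" using xy A by blast+
    have "inv\<^bsub>free_group Z\<^esub> x \<otimes>\<^bsub>free_group Z\<^esub> y \<noteq> []"
    proof
      assume "inv\<^bsub>free_group Z\<^esub> x \<otimes>\<^bsub>free_group Z\<^esub> y = []"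
      then have "x = y"
        using F.mult_inv_cancel_left(1)[OF x] x(1) F.r_one[of x] by (simp add: one_free_group)
      then show False using xy(3) by simp
    qed
    then have "?d x y \<noteq> 0" using N_definite[of "inv\<^bsub>free_group Z\<^esub> x \<otimes>\<^bsub>free_group Z\<^esub> y"] x by auto
    then show ?thesis using F.length_nonneg[of "inv\<^bsub>free_group Z\<^esub> x \<otimes>\<^bsub>free_group Z\<^esub> y"] x by simp
  qed
  then have "\<forall>t\<in>?D. 0 < t" by auto
  then have e: "0 < e" using Min_in[OF D] unfolding e_def by blast
  have e_le: "e \<le> ?d x y" if "x \<in> ?A" "y \<in> ?A" "x \<noteq> y" for x y
    unfolding e_def
    by (rule Min_le[OF D], rule insertI2, rule image_eqI[of _ _ "(x, y)"]) (use that in simp_all)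
  have "e \<le> 1" unfolding e_def by (rule Min_le[OF D]) simp
  then obtain l where l: "l \<in> lists (commutator_weights X Z N)" "word_prod P l = p" "word_cost l < e"
    using K.weighted_length_less[of p e] e \<open>k p = 0\<close> by auto
  \<comment> \<open>The function \<open>f\<close> picks for each weighted element the pair of points that has to be glued to kill it.\<close>
  have "\<exists>f. \<forall>x\<in>commutator_weights X Z N. fst (f x) \<in> carrier (free_group Z) \<and> snd (f x) \<in> carrier (free_group Z) \<and>
      ?d (fst (f x)) (snd (f x)) = snd x \<and> R (fst x) = [] \<and>
      (\<forall>c :: 'a free_word \<Rightarrow> 'a free_word set. c (fst (f x)) = c (snd (f x)) \<longrightarrow> coset_eval c Z [] (fst x) = [])"
  proof (rule bchoice, rule ballI)
    fix x assume "x \<in> commutator_weights X Z N"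
    then obtain u y g where *: "u \<in> carrier P" "y \<in> X - Z" "g \<in> carrier (free_group Z)"
        "fst x = u \<otimes>\<^bsub>P\<^esub> comm y g \<otimes>\<^bsub>P\<^esub> inv\<^bsub>P\<^esub> u" "snd x = N g"
      using commutator_weightsE[of "fst x" "snd x"] by auto
    have Ru: "R u \<in> carrier (free_group Z)" by (rule retract_in_carrier)
    have "R (fst x) = \<one>\<^bsub>P\<^esub>"
    proof -
      have "comm y g \<in> carrier P" using * by (simp add: free_gen_carrier subgroup_carrier)
      then have "R (fst x) = R u \<otimes>\<^bsub>P\<^esub> R (comm y g) \<otimes>\<^bsub>P\<^esub> inv\<^bsub>P\<^esub> R u"
        using *(1) unfolding *(4) by (metis P.m_closed P.inv_closed R.hom_mult R.hom_inv)
      then show ?thesis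
        using retract_comm[OF *(2,3)] *(1) R.hom_closed[OF *(1)] by (simp add: one_free_group[of X, symmetric])
    qed
    moreover have "?d (R u) (R u \<otimes>\<^bsub>P\<^esub> g) = N g"
      using F.mult_inv_cancel_left(2)[OF Ru *(3)] by (simp add: mult_subgroup)
    moreover have "R u \<otimes>\<^bsub>P\<^esub> g \<in> carrier (free_group Z)"
      using F.m_closed[OF Ru *(3)] by (simp add: mult_subgroup)
    moreover have "coset_eval c Z [] (fst x) = []" if "c (R u) = c (R u \<otimes>\<^bsub>P\<^esub> g)"
      for c :: "'a free_word \<Rightarrow> 'a free_word set"
      unfolding *(4) by (rule coset_eval_conj_comm[OF *(1-3) that])
    ultimately show "\<exists>f. fst f \<in> carrier (free_group Z) \<and> snd f \<in> carrier (free_group Z) \<and>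
        ?d (fst f) (snd f) = snd x \<and> R (fst x) = [] \<and>
        (\<forall>c :: 'a free_word \<Rightarrow> 'a free_word set. c (fst f) = c (snd f) \<longrightarrow> coset_eval c Z [] (fst x) = [])"
      using Ru *(5)
      by (intro exI[of _ "(R u, R u \<otimes>\<^bsub>P\<^esub> g)"]) (simp add: one_free_group)
  qed
  then obtain f where f: "\<And>x. x \<in> commutator_weights X Z N \<Longrightarrow> fst (f x) \<in> carrier (free_group Z) \<and> snd (f x) \<in> carrier (free_group Z) \<and>
      ?d (fst (f x)) (snd (f x)) = snd x \<and> R (fst x) = [] \<and>
      (\<forall>c :: 'a free_word \<Rightarrow> 'a free_word set. c (fst (f x)) = c (snd (f x)) \<longrightarrow> coset_eval c Z [] (fst x) = [])"
    by blast
  have costs: "map (\<lambda>(a, b). ?d a b) (map f l) = map snd l"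
    using l(1) f by (auto simp: case_prod_unfold)
  then have sum: "sum_list (map (\<lambda>(a, b). ?d a b) (map f l)) < e"
    using l(3) by (simp only: costs word_cost_def)
  have ps: "a \<in> carrier (free_group Z) \<and> b \<in> carrier (free_group Z)" if "(a, b) \<in> set (map f l)" for a b
    using that l(1) f by (metis (no_types, lifting) fst_conv snd_conv imageE in_listsD list.set_map)
  obtain c :: "'a free_word \<Rightarrow> 'a free_word set" where
      c: "inj_on c ?A" "\<forall>(a, b) \<in> set (map f l). c a = c b"
    using separating_quotient[OF F_pseudometric ps A e_le sum] by blast
  have "coset_eval c Z [] (word_prod P l) = [] \<and> R (word_prod P l) = []"
    using l(1) c(2)
  proof (induction l rule: lists.induct)
    case Nil
    show ?case by (simp add: one_free_group)
  next
    case (Cons x l)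
    then have IH: "coset_eval c Z [] (word_prod P l) = []" "R (word_prod P l) = []" by auto
    have "c (fst (f x)) = c (snd (f x))" using Cons.prems by (simp add: case_prod_unfold)
    then have x: "R (fst x) = []" "coset_eval c Z [] (fst x) = []" using f[OF Cons.hyps(1)] by auto
    have "fst x \<in> carrier P" "word_prod P l \<in> carrier P"
      using K.weighted_carrier[of "fst x" "snd x"] Cons.hyps K.word_prod_closed by auto
    then show ?case
      using IH x by (simp add: coset_eval_mult) (simp add: mult_free_group reduce_word_def)
  qed
  then show False
    using coset_eval_nontrivial[OF p Rp \<open>p \<noteq> []\<close> c(1)] l(2) by simp
qed

lemma L_length: "group_length P L"
  by (rule P.twisted_length[OF retract_length K.group_length_axioms R_hom k_conj])

lemma L_definite:
  assumes p: "p \<in> carrier P" and "L p = 0"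
  shows "p = \<one>\<^bsub>P\<^esub>"
proof -
  have "0 \<le> N (R p)" "0 \<le> k (p \<otimes>\<^bsub>P\<^esub> inv\<^bsub>P\<^esub> (R p))"
    by (auto intro: F.length_nonneg retract_in_carrier K.weighted_length_nonneg)
  then have N0: "N (R p) = 0" and k0: "k (p \<otimes>\<^bsub>P\<^esub> inv\<^bsub>P\<^esub> (R p)) = 0"
    using assms(2) by linarith+
  have Rp: "R p = []" using N_definite[OF retract_in_carrier N0] .
  then have "k p = 0" using k0 p by (simp add: one_free_group[of X, symmetric])
  then show ?thesis using k_definite[OF p Rp] by (simp add: one_free_group)
qed

lemma L_conj:
  assumes p: "p \<in> carrier P" and e: "e > 0"
  shows "\<exists>d>0. \<forall>q\<in>carrier P. L q < d \<longrightarrow> L (p \<otimes>\<^bsub>P\<^esub> q \<otimes>\<^bsub>P\<^esub> inv\<^bsub>P\<^esub> p) < e"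
proof (rule P.twisted_length_conj[OF retract_length K.group_length_axioms R_hom k_conj _ _ p e])
  fix e :: real assume e: "e > 0"
  show "\<exists>d>0. \<forall>q\<in>carrier P. N (R q) < d \<longrightarrow> N (R (p \<otimes>\<^bsub>P\<^esub> q \<otimes>\<^bsub>P\<^esub> inv\<^bsub>P\<^esub> p)) < e"
    using N_conj'[OF retract_in_carrier e, of p] p retract_in_carrier by auto
  show "\<exists>d>0. \<forall>q\<in>carrier P. N (R q) < d \<longrightarrow>
      k (R q \<otimes>\<^bsub>P\<^esub> (inv\<^bsub>P\<^esub> p \<otimes>\<^bsub>P\<^esub> R p) \<otimes>\<^bsub>P\<^esub> inv\<^bsub>P\<^esub> (R q) \<otimes>\<^bsub>P\<^esub> inv\<^bsub>P\<^esub> (inv\<^bsub>P\<^esub> p \<otimes>\<^bsub>P\<^esub> R p)) < e"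
    using k_commutator_small[OF p e] retract_in_carrier by blast
qed

lemma L_subgroup: "g \<in> carrier (free_group Z) \<Longrightarrow> N g = L g"
  by (simp add: R_subgroup subgroup_carrier K.length_one)

end

theorem theorem3p4:
  fixes X Z :: "'a set" and T :: "'a free_word topology"
  assumes "Z \<subseteq> X"
    and "separable_metric_group_topology (free_group Z) T"
  shows "\<exists>T'. group_topology (free_group X) T' \<and> Hausdorff_space T' \<and>
              subtopology T' (carrier (free_group Z)) = T"
proof -
  have "group_topology (free_group Z) T" "metrizable_space T"
    using assms(2) by (auto simp: separable_metric_group_topology_def)
  then obtain N where N: "group_length (free_group Z) N"
      "\<forall>x\<in>carrier (free_group Z). N x = 0 \<longrightarrow> x = \<one>\<^bsub>free_group Z\<^esub>"
      "\<forall>p\<in>carrier (free_group Z). \<forall>e>0. \<exists>d>0. \<forall>q\<in>carrier (free_group Z). N q < d \<longrightarrow>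
        N (p \<otimes>\<^bsub>free_group Z\<^esub> q \<otimes>\<^bsub>free_group Z\<^esub> inv\<^bsub>free_group Z\<^esub> p) < e"
      "length_topology (free_group Z) N = T"
    using Birkhoff_Kakutani by blast
  interpret normed_free_factor X Z N
    using assms(1) N by (simp add: normed_free_factor_def one_free_group)
  interpret L: group_length P L by (rule L_length)
  have "group_topology P (length_topology P L)"
    using L_conj by (rule L.group_topology_length_topology)
  moreover have "Hausdorff_space (length_topology P L)"
    using L_definite by (rule L.Hausdorff_length_topology)
  moreover have "subtopology (length_topology P L) (carrier (free_group Z)) = length_topology (free_group Z) N"
    by (rule length_topology_subgroup[OF L_length group_free_group])
      (simp_all add: mult_subgroup L_subgroup subgroup_carrier subsetI)
  ultimately show ?thesis
    using N(4) by blast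
qed

end
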